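(* Let $f$ and $g$ be hyperbolic entire functions of bounded type satisfying $f\circ g=g\circ f$. Then $f\circ g$ is hyperbolic.
   Context: For an entire function $h$, $h^n$ denotes the $n$-th iterate ($h^0$ is the identity). The Fatou set of $h$ is $F(h)=\{z\in\mathbb{C}: \{h^n\}_{n\in\mathbb{N}} \text{ is normal in some neighborhood of } z\}$. A critical value of $h$ is a point $w=h(w_0)$ with $h'(w_0)=0$. A point $\xi\in\mathbb{C}$ is an asymptotic value of $h$ if there is a curve $\Gamma$ tending to infinity such that $h(z)\to\xi$ as $z\to\infty$ along $\Gamma$. $\mathrm{Sing}(h^{-1})$ is the set of critical values and asymptotic values of $h$ and their finite limit points. An entire function $h$ is of bounded type if it is transcendental and $\mathrm{Sing}(h^{-1})$ is bounded. The postsingular set of $h$ is $\mathcal{P}(h)=\overline{\bigcup_{n\ge 0}h^n(\mathrm{Sing}(h^{-1}))}$ (closure in $\mathbb{C}$). An entire function $h$ is called hyperbolic if $\mathcal{P}(h)$ is a compact subset of $F(h)$. *)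

theory Defs
  imports "HOL-Complex_Analysis.Complex_Analysis"
begin

definition entire :: "(complex \<Rightarrow> complex) \<Rightarrow> bool" where
  "entire h \<longleftrightarrow> h holomorphic_on UNIV"

definition transcendental_entire :: "(complex \<Rightarrow> complex) \<Rightarrow> bool" where
  "transcendental_entire h \<longleftrightarrow> entire h \<and> \<not> (\<exists>p. \<forall>z. h z = poly p z)"

text \<open>
  Normality in the sense of Montel, with values in the Riemann sphere: the constant
  \<open>\<infinity>\<close> is admitted as a limit.  The definition is meant for families of holomorphic
  functions on a connected open set \<open>U\<close>; there, by Hurwitz's theorem, a locally
  uniform limit in the spherical metric is either holomorphic or identically \<open>\<infinity>\<close>.
\<close>

definition normal_family_on :: "complex set \<Rightarrow> (complex \<Rightarrow> complex) set \<Rightarrow> bool" where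
  "normal_family_on U \<F> \<longleftrightarrow>
     (\<forall>s :: nat \<Rightarrow> complex \<Rightarrow> complex. range s \<subseteq> \<F> \<longrightarrow>
        (\<exists>r :: nat \<Rightarrow> nat. strict_mono r \<and>
           ((\<exists>l. l holomorphic_on U \<and>
               (\<forall>K. compact K \<and> K \<subseteq> U \<longrightarrow> uniform_limit K (\<lambda>n. s (r n)) l sequentially)) \<or>
            (\<forall>K. compact K \<and> K \<subseteq> U \<longrightarrow>
               (\<forall>B. \<forall>\<^sub>F n in sequentially. \<forall>z\<in>K. B \<le> norm (s (r n) z))))))"

definition Fatou_set :: "(complex \<Rightarrow> complex) \<Rightarrow> complex set" where
  "Fatou_set h = {z. \<exists>U. open U \<and> connected U \<and> z \<in> U \<and>
                        normal_family_on U (range (\<lambda>n. h ^^ n))}"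

definition critical_values :: "(complex \<Rightarrow> complex) \<Rightarrow> complex set" where
  "critical_values h = {h w | w. deriv h w = 0}"

definition asymptotic_values :: "(complex \<Rightarrow> complex) \<Rightarrow> complex set" where
  "asymptotic_values h =
     {\<xi>. \<exists>\<gamma> :: real \<Rightarrow> complex. continuous_on {0..} \<gamma> \<and>
          filterlim \<gamma> at_infinity at_top \<and> ((\<lambda>t. h (\<gamma> t)) \<longlongrightarrow> \<xi>) at_top}"

text \<open>The closure in \<open>\<complex>\<close> adds precisely the finite limit points.\<close>

definition singular_values :: "(complex \<Rightarrow> complex) \<Rightarrow> complex set" where
  "singular_values h = closure (critical_values h \<union> asymptotic_values h)"

definition bounded_type :: "(complex \<Rightarrow> complex) \<Rightarrow> bool" where
  "bounded_type h \<longleftrightarrow> transcendental_entire h \<and> bounded (singular_values h)"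

definition postsingular_set :: "(complex \<Rightarrow> complex) \<Rightarrow> complex set" where
  "postsingular_set h = closure (\<Union>n. (h ^^ n) ` singular_values h)"

definition hyperbolic_entire :: "(complex \<Rightarrow> complex) \<Rightarrow> bool" where
  "hyperbolic_entire h \<longleftrightarrow>
     entire h \<and> compact (postsingular_set h) \<and> postsingular_set h \<subseteq> Fatou_set h"

end

theory Submission
  imports Defs
begin

text \<open>
  Write \<open>S\<close> for the singular values and \<open>P\<close> for the postsingular set of \<open>f\<close>, and let \<open>B\<close> be the set
  of points that have a neighbourhood on which all iterates of \<open>f\<close> are bounded by one constant.
  By Montel's theorem \<open>B\<close> lies in the Fatou set, and for hyperbolic \<open>f\<close> it contains \<open>P\<close>: the orbits
  in \<open>P\<close> are bounded, which excludes the limit \<open>\<infinity>\<close>.  The set \<open>B\<close> is easier to handle than the Fatou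
  set because a nonconstant entire \<open>g\<close> commuting with \<open>f\<close> maps it to itself, simply by
  \<open>f ^^ n \<circ> g = g \<circ> f ^^ n\<close>.

  The singular values of \<open>f \<circ> g\<close> lie in those of \<open>f\<close> and the \<open>f\<close>-image of those of \<open>g\<close>.  Hence, by
  symmetry, it suffices that the orbits of \<open>S\<close> under \<open>f \<circ> g\<close> stay in a compact set of points with
  locally bounded \<open>f \<circ> g\<close>-orbits.  This is \<open>singular_orbits_of_composition\<close>, and it rests on Schwarz's
  lemma.  The components of \<open>B\<close> are simply connected by the maximum principle, and \<open>B\<close> is not the
  whole plane, so the components are conformal discs.  The compact set \<open>P\<close> meets only finitely many
  of them, so the orbit of a point of \<open>P\<close> returns to some component \<open>W\<close>; an iterate of \<open>f\<close> then acts
  on \<open>W\<close> as a self-map of a disc with a relatively compact orbit, and such a map has a fixed point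
  (\<open>disc_self_map_fixed_point\<close>).  Thus \<open>P\<close> is absorbed by the components containing periodic
  points of \<open>f\<close>.

  Each component contains at most one periodic point, since a self-map of a disc with two fixed points
  is the identity.  Unless \<open>P\<close> is empty, which leaves nothing to prove,
  each component with a periodic point meets \<open>P\<close>
  (\<open>periodic_component_meets_postsingular\<close>): otherwise the return map would be a rotation,
  and its inverse branches, continued across the boundary, would make the iterates of \<open>f\<close> bounded near a
  boundary point of \<open>B\<close>.  So there are only finitely many periodic points in \<open>B\<close>, and both \<open>f\<close> and
  \<open>g\<close> map the set of these points into itself.  In Riemann
  coordinates that vanish at these points, Schwarz's lemma says that neither \<open>f\<close> nor \<open>g\<close> increases
  the modulus.  The points of modulus at most \<open>r < 1\<close> form a compact set that is invariant under
  \<open>f\<close>, \<open>g\<close> and \<open>f \<circ> g\<close>, and for \<open>r\<close> close to \<open>1\<close> it absorbs the orbits in \<open>P\<close>.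
\<close>

section \<open>Points with locally bounded orbits\<close>

definition bounded_orbit_set :: "(complex \<Rightarrow> complex) \<Rightarrow> complex set" where
  "bounded_orbit_set f = {z. \<exists>e>0. \<exists>M. \<forall>n. \<forall>w\<in>ball z e. norm ((f ^^ n) w) \<le> M}"

lemma bounded_orbit_setI:
  assumes "open U" "z \<in> U" "\<And>n w. w \<in> U \<Longrightarrow> norm ((f ^^ n) w) \<le> M"
  shows "z \<in> bounded_orbit_set f"
proof -
  obtain e where "e > 0" "ball z e \<subseteq> U"
    using assms(1,2) open_contains_ball by blast
  then show ?thesis
    unfolding bounded_orbit_set_def using assms(3) by blast
qed

lemma open_bounded_orbit_set: "open (bounded_orbit_set f)"
  unfolding open_contains_ball
proof
  fix z assume "z \<in> bounded_orbit_set f"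
  then obtain e M where "e > 0" and M: "\<And>n w. w \<in> ball z e \<Longrightarrow> norm ((f ^^ n) w) \<le> M"
    unfolding bounded_orbit_set_def by blast
  have "ball z e \<subseteq> bounded_orbit_set f"
    using bounded_orbit_setI[OF open_ball _ M] by blast
  with \<open>e > 0\<close> show "\<exists>e>0. ball z e \<subseteq> bounded_orbit_set f" by blast
qed

lemma bounded_orbit_set_compact:
  assumes "compact K" "K \<subseteq> bounded_orbit_set f"
  obtains M where "\<And>n w. w \<in> K \<Longrightarrow> norm ((f ^^ n) w) \<le> M"
proof -
  have "\<forall>z\<in>K. \<exists>e M. e > 0 \<and> (\<forall>n. \<forall>w\<in>ball z e. norm ((f ^^ n) w) \<le> M)"
    using assms(2) unfolding bounded_orbit_set_def by blast
  then obtain e M where e: "\<And>z. z \<in> K \<Longrightarrow> e z > 0"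
    and M: "\<And>z n w. z \<in> K \<Longrightarrow> w \<in> ball z (e z) \<Longrightarrow> norm ((f ^^ n) w) \<le> M z"
    by metis
  have "K \<subseteq> (\<Union>z\<in>K. ball z (e z))"
    using e by force
  then obtain C where C: "C \<subseteq> K" "finite C" "K \<subseteq> (\<Union>z\<in>C. ball z (e z))"
    using compactE_image[OF assms(1), of K "\<lambda>z. ball z (e z)"] by auto
  have "norm ((f ^^ n) w) \<le> (\<Sum>z\<in>C. \<bar>M z\<bar>)" if w: "w \<in> K" for n w
  proof -
    obtain z where z: "z \<in> C" "w \<in> ball z (e z)" using C w by blast
    then have "norm ((f ^^ n) w) \<le> \<bar>M z\<bar>"
      using M C by (meson abs_ge_self order_trans subsetD)
    also have "\<dots> \<le> (\<Sum>z\<in>C. \<bar>M z\<bar>)"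
      using C(2) z(1) by (intro member_le_sum) auto
    finally show ?thesis .
  qed
  then show ?thesis using that by blast
qed

lemma entire_funpow:
  assumes "entire f" shows "entire (f ^^ n)"
proof (induction n)
  case 0
  then show ?case by (simp add: entire_def id_def)
next
  case (Suc n)
  then show ?case
    using assms holomorphic_on_compose_gen[of "f ^^ n" UNIV f UNIV]
    unfolding entire_def by simp
qed

lemma entire_imp_continuous_on: "entire f \<Longrightarrow> continuous_on A f"
  unfolding entire_def
  by (meson continuous_on_subset holomorphic_on_imp_continuous_on subset_UNIV)

lemma entire_bounded_on_compact:
  assumes "entire f" "compact K"
  obtains C where "\<And>z. z \<in> K \<Longrightarrow> norm (f z) \<le> C"
proof -
  have "compact (f ` K)"
    using assms compact_continuous_image entire_imp_continuous_on by blast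
  then have "bounded (f ` K)" by (rule compact_imp_bounded)
  then show ?thesis using that unfolding bounded_iff by blast
qed

lemma entire_open_map:
  assumes "entire f" "\<not> f constant_on UNIV" "open U"
  shows "open (f ` U)"
  using assms open_mapping_thm[of f UNIV U] unfolding entire_def by auto

lemma transcendental_not_constant:
  assumes "transcendental_entire f"
  shows "\<not> f constant_on UNIV"
proof
  assume "f constant_on UNIV"
  then obtain c where "\<And>z. f z = c" unfolding constant_on_def by auto
  then have "\<forall>z. f z = poly [:c:] z" by simp
  then show False using assms unfolding transcendental_entire_def by blast
qed

lemma bounded_orbit_set_vimage:
  assumes "entire f" "f z \<in> bounded_orbit_set f"
  shows "z \<in> bounded_orbit_set f"
proof -
  obtain e M where "e > 0" and M: "\<And>n w. w \<in> ball (f z) e \<Longrightarrow> norm ((f ^^ n) w) \<le> M"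
    using assms(2) unfolding bounded_orbit_set_def by blast
  define U where "U = f -` ball (f z) e \<inter> ball z 1"
  have "open U"
    unfolding U_def using assms(1)
    by (intro open_Int open_vimage) (auto intro: entire_imp_continuous_on)
  moreover have "z \<in> U" using \<open>e > 0\<close> by (simp add: U_def)
  moreover have "norm ((f ^^ n) w) \<le> max M (norm z + 1)" if "w \<in> U" for n w
  proof (cases n)
    case 0
    have "dist z w < 1" using that by (simp add: U_def)
    then have "norm w \<le> norm z + 1"
      by (smt (verit) dist_norm norm_minus_commute norm_triangle_sub)
    with 0 show ?thesis by simp
  next
    case (Suc m)
    have "norm ((f ^^ m) (f w)) \<le> M" using that M unfolding U_def by blast
    then show ?thesis using Suc by (simp add: funpow_swap1 le_max_iff_disj)
  qed
  ultimately show ?thesis by (rule bounded_orbit_setI)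
qed

lemma bounded_orbit_set_vimage_funpow:
  assumes "entire f" "(f ^^ n) z \<in> bounded_orbit_set f"
  shows "z \<in> bounded_orbit_set f"
  using assms(2)
  by (induction n) (auto intro: bounded_orbit_set_vimage[OF assms(1)])

lemma funpow_commute:
  assumes "\<And>z. f (g z) = g (f z)"
  shows "(f ^^ n) (g z) = g ((f ^^ n) z)"
  by (induction n) (auto simp: assms)

lemma funpow_comp_commuting:
  assumes "\<And>z. f (g z) = g (f z)"
  shows "((f \<circ> g) ^^ n) z = (g ^^ n) ((f ^^ n) z)"
proof (induction n)
  case (Suc n)
  have "((f \<circ> g) ^^ Suc n) z = f (g ((g ^^ n) ((f ^^ n) z)))"
    by (simp only: funpow.simps o_apply Suc.IH)
  also have "\<dots> = (g ^^ Suc n) (f ((f ^^ n) z))"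
    using funpow_commute[of g f "Suc n" "(f ^^ n) z"] assms by simp
  also have "\<dots> = (g ^^ Suc n) ((f ^^ Suc n) z)" by simp
  finally show ?case .
qed auto

text \<open>
  The image under \<open>g\<close> of a good neighbourhood is a neighbourhood, as \<open>g\<close> is open, and there
  \<open>f ^^ n\<close> takes only values that \<open>g\<close> assumes on a fixed disc.
\<close>

lemma bounded_orbit_set_commuting_image:
  assumes "entire g" "\<not> g constant_on UNIV" "\<And>z. f (g z) = g (f z)"
    and "z \<in> bounded_orbit_set f"
  shows "g z \<in> bounded_orbit_set f"
proof -
  obtain e M where "e > 0" and M: "\<And>n w. w \<in> ball z e \<Longrightarrow> norm ((f ^^ n) w) \<le> M"
    using assms(4) unfolding bounded_orbit_set_def by blast
  obtain C where C: "\<And>w. w \<in> cball 0 M \<Longrightarrow> norm (g w) \<le> C"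
    using entire_bounded_on_compact[OF assms(1) compact_cball] by blast
  show ?thesis
  proof (rule bounded_orbit_setI)
    show "open (g ` ball z e)" by (rule entire_open_map) (use assms in auto)
    show "g z \<in> g ` ball z e" using \<open>e > 0\<close> by auto
    fix n w assume "w \<in> g ` ball z e"
    then obtain v where v: "v \<in> ball z e" "w = g v" by blast
    then show "norm ((f ^^ n) w) \<le> C"
      using C M by (simp add: funpow_commute assms(3))
  qed
qed

lemma bounded_orbit_set_image:
  assumes "entire f" "\<not> f constant_on UNIV" "z \<in> bounded_orbit_set f"
  shows "(f ^^ n) z \<in> bounded_orbit_set f"
  by (induction n) (auto simp: assms intro: bounded_orbit_set_commuting_image)

lemma bounded_orbit_set_subset_Fatou:
  assumes "entire f"
  shows "bounded_orbit_set f \<subseteq> Fatou_set f"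
proof
  fix z assume "z \<in> bounded_orbit_set f"
  then obtain e M where "e > 0" and M: "\<And>n w. w \<in> ball z e \<Longrightarrow> norm ((f ^^ n) w) \<le> M"
    unfolding bounded_orbit_set_def by blast
  have "normal_family_on (ball z e) (range (\<lambda>n. f ^^ n))"
    unfolding normal_family_on_def
  proof (intro allI impI)
    fix s :: "nat \<Rightarrow> complex \<Rightarrow> complex" assume s: "range s \<subseteq> range (\<lambda>n. f ^^ n)"
    obtain l r where "l holomorphic_on ball z e" "strict_mono (r :: nat \<Rightarrow> nat)"
      and "\<And>K. \<lbrakk>compact K; K \<subseteq> ball z e\<rbrakk> \<Longrightarrow> uniform_limit K (s \<circ> r) l sequentially"
    proof (rule Montel[of "ball z e" "range (\<lambda>n. f ^^ n)" s])
      show "\<And>h. h \<in> range (\<lambda>n. f ^^ n) \<Longrightarrow> h holomorphic_on ball z e"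
        using entire_funpow[OF assms] unfolding entire_def
        by (auto intro: holomorphic_on_subset)
      show "\<exists>B. \<forall>h\<in>range (\<lambda>n. f ^^ n). \<forall>z\<in>K. cmod (h z) \<le> B"
        if "compact K" "K \<subseteq> ball z e" for K
        using M that by blast
    qed (use s in auto)
    then show "\<exists>r. strict_mono r \<and>
           ((\<exists>l. l holomorphic_on ball z e \<and>
               (\<forall>K. compact K \<and> K \<subseteq> ball z e \<longrightarrow> uniform_limit K (\<lambda>n. s (r n)) l sequentially)) \<or>
            (\<forall>K. compact K \<and> K \<subseteq> ball z e \<longrightarrow>
               (\<forall>B. \<forall>\<^sub>F n in sequentially. \<forall>z\<in>K. B \<le> norm (s (r n) z))))"
      unfolding o_def by blast
  qed
  then show "z \<in> Fatou_set f"
    unfolding Fatou_set_def using \<open>e > 0\<close> by (auto intro!: exI[of _ "ball z e"])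
qed

text \<open>
  Iterates with ever larger values near \<open>z\<close> can converge neither to a holomorphic limit nor, while
  they are bounded at \<open>z\<close> itself, to \<open>\<infinity>\<close>.
\<close>

lemma Fatou_bounded_orbit_imp_bounded_orbit_set:
  assumes "z \<in> Fatou_set f" "bounded (range (\<lambda>n. (f ^^ n) z))"
  shows "z \<in> bounded_orbit_set f"
proof (rule ccontr)
  assume not: "z \<notin> bounded_orbit_set f"
  obtain U where U: "open U" "z \<in> U" "normal_family_on U (range (\<lambda>n. f ^^ n))"
    using assms(1) unfolding Fatou_set_def by blast
  obtain e where e: "e > 0" "cball z e \<subseteq> U"
    using U open_contains_cball by blast
  obtain C where C: "\<And>n. norm ((f ^^ n) z) \<le> C"
    using assms(2) unfolding bounded_iff by blast
  have "\<exists>n. \<exists>w\<in>ball z e. real j < norm ((f ^^ n) w)" for j :: nat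
    using not e(1) unfolding bounded_orbit_set_def by (auto simp: not_le)
  then obtain N w where w: "\<And>j. w j \<in> ball z e" "\<And>j. real j < norm ((f ^^ N j) (w j))"
    by metis
  have "range (\<lambda>j. f ^^ N j) \<subseteq> range (\<lambda>n. f ^^ n)" by blast
  then obtain r :: "nat \<Rightarrow> nat" where r: "strict_mono r" and
    alt: "(\<exists>l. l holomorphic_on U \<and>
               (\<forall>K. compact K \<and> K \<subseteq> U \<longrightarrow> uniform_limit K (\<lambda>n. f ^^ N (r n)) l sequentially)) \<or>
            (\<forall>K. compact K \<and> K \<subseteq> U \<longrightarrow>
               (\<forall>B. \<forall>\<^sub>F n in sequentially. \<forall>z\<in>K. B \<le> norm ((f ^^ N (r n)) z)))"
    using U(3) unfolding normal_family_on_def by blast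
  from alt show False
  proof
    assume "\<exists>l. l holomorphic_on U \<and>
               (\<forall>K. compact K \<and> K \<subseteq> U \<longrightarrow> uniform_limit K (\<lambda>n. f ^^ N (r n)) l sequentially)"
    then obtain l where l: "l holomorphic_on U"
      and lim: "uniform_limit (cball z e) (\<lambda>n. f ^^ N (r n)) l sequentially"
      using e by auto
    have "bounded (l ` cball z e)"
      by (intro compact_imp_bounded compact_continuous_image)
         (use l e in \<open>auto intro: holomorphic_on_imp_continuous_on continuous_on_subset\<close>)
    then obtain L where L: "\<And>v. v \<in> cball z e \<Longrightarrow> norm (l v) \<le> L"
      unfolding bounded_iff by (metis imageI)
    have "\<forall>\<^sub>F n in sequentially. \<forall>v\<in>cball z e. dist ((f ^^ N (r n)) v) (l v) < 1"
      using lim unfolding uniform_limit_iff by auto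
    then obtain n0 where n0: "\<And>n v. n \<ge> n0 \<Longrightarrow> v \<in> cball z e \<Longrightarrow> dist ((f ^^ N (r n)) v) (l v) < 1"
      unfolding eventually_sequentially by blast
    define n where "n = max n0 (nat \<lceil>L + 1\<rceil>)"
    have "w (r n) \<in> cball z e" using w(1) by (meson ball_subset_cball subsetD)
    then have "norm ((f ^^ N (r n)) (w (r n))) \<le> L + 1"
      using n0[of n "w (r n)"] L[of "w (r n)"] norm_triangle_sub[of "(f ^^ N (r n)) (w (r n))" "l (w (r n))"]
      by (simp add: n_def dist_norm)
    moreover have "L + 1 \<le> real n" unfolding n_def by linarith
    moreover have "n \<le> r n" using r by (rule seq_suble)
    ultimately show False using w(2)[of "r n"] by linarith
  next
    assume inf: "\<forall>K. compact K \<and> K \<subseteq> U \<longrightarrow>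
               (\<forall>B. \<forall>\<^sub>F n in sequentially. \<forall>z\<in>K. B \<le> norm ((f ^^ N (r n)) z))"
    have "\<forall>\<^sub>F n in sequentially. \<forall>v\<in>{z}. C + 1 \<le> norm ((f ^^ N (r n)) v)"
      using inf[rule_format, of "{z}" "C + 1"] U(2) by auto
    then obtain n where "C + 1 \<le> norm ((f ^^ N (r n)) z)"
      unfolding eventually_sequentially by auto
    with C[of "N (r n)"] show False by linarith
  qed
qed

lemma singular_subset_postsingular: "singular_values f \<subseteq> postsingular_set f"
proof -
  have "singular_values f = (f ^^ 0) ` singular_values f" by simp
  then have "singular_values f \<subseteq> (\<Union>n. (f ^^ n) ` singular_values f)" by blast
  then show ?thesis unfolding postsingular_set_def using closure_subset by blast
qed

lemma postsingular_invariant: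
  assumes "entire f" "z \<in> postsingular_set f"
  shows "(f ^^ n) z \<in> postsingular_set f"
proof -
  have 1: "f ` postsingular_set f \<subseteq> postsingular_set f"
    unfolding postsingular_set_def
  proof (rule image_closure_subset)
    show "continuous_on (closure (\<Union>n. (f ^^ n) ` singular_values f)) f"
      using assms(1) by (rule entire_imp_continuous_on)
    have "f ` (\<Union>n. (f ^^ n) ` singular_values f) \<subseteq> (\<Union>n. (f ^^ n) ` singular_values f)"
    proof
      fix y assume "y \<in> f ` (\<Union>n. (f ^^ n) ` singular_values f)"
      then obtain n s where "s \<in> singular_values f" "y = (f ^^ Suc n) s" by auto
      then show "y \<in> (\<Union>n. (f ^^ n) ` singular_values f)" by blast
    qed
    then show "f ` (\<Union>n. (f ^^ n) ` singular_values f) \<subseteq> closure (\<Union>n. (f ^^ n) ` singular_values f)"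
      by (rule order_trans[OF _ closure_subset])
  qed auto
  show ?thesis by (induction n) (use 1 assms in auto)
qed

lemma hyperbolic_postsingular_subset:
  assumes "hyperbolic_entire f"
  shows "postsingular_set f \<subseteq> bounded_orbit_set f"
proof
  fix z assume z: "z \<in> postsingular_set f"
  have "range (\<lambda>n. (f ^^ n) z) \<subseteq> postsingular_set f"
    using postsingular_invariant z assms unfolding hyperbolic_entire_def by blast
  then have "bounded (range (\<lambda>n. (f ^^ n) z))"
    using assms unfolding hyperbolic_entire_def by (meson bounded_subset compact_imp_bounded)
  then show "z \<in> bounded_orbit_set f"
    using Fatou_bounded_orbit_imp_bounded_orbit_set z assms unfolding hyperbolic_entire_def by blast
qed

section \<open>Singular values and lifting through an entire function\<close>

text \<open>
  If the curve returns to a compact set infinitely often, it accumulates at some \<open>w\<close> with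
  \<open>f w = \<xi>\<close>.  Solutions of this equation are isolated, so on small circles about \<open>w\<close> the values of
  \<open>f\<close> stay away from \<open>\<xi>\<close>, and the curve cannot cross these circles any more once its image is
  close to \<open>\<xi>\<close>.
\<close>

lemma entire_curve_limit_dichotomy:
  assumes f: "entire f" "\<not> f constant_on UNIV"
    and \<gamma>: "continuous_on {0..} \<gamma>" and lim: "((\<lambda>t. f (\<gamma> t)) \<longlongrightarrow> \<xi>) at_top"
    and not_inf: "\<not> filterlim \<gamma> at_infinity (at_top :: real filter)"
  obtains w where "f w = \<xi>" "(\<gamma> \<longlongrightarrow> w) at_top"
proof -
  obtain r where r: "\<And>T. \<exists>t\<ge>T. norm (\<gamma> t) < r"
    using not_inf unfolding filterlim_at_infinity[OF order.refl] eventually_at_top_linorder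
    by (auto simp: not_le)
  then have "\<forall>n::nat. \<exists>t. t \<ge> real n \<and> norm (\<gamma> t) < r" by blast
  then obtain \<tau> where \<tau>: "\<And>n::nat. \<tau> n \<ge> real n" "\<And>n. norm (\<gamma> (\<tau> n)) < r"
    by metis
  have "\<forall>n. \<gamma> (\<tau> n) \<in> cball 0 r"
    using \<tau>(2) by (simp add: less_imp_le)
  then obtain w s where w: "strict_mono (s :: nat \<Rightarrow> nat)" "((\<lambda>n. \<gamma> (\<tau> n)) \<circ> s) \<longlonglongrightarrow> w"
    using compact_cball[of 0 r] unfolding compact_def by metis
  have top: "filterlim (\<lambda>n. \<tau> (s n)) at_top sequentially"
  proof (rule filterlim_at_top_mono)
    show "filterlim (\<lambda>n. real n) at_top sequentially" by (rule filterlim_real_sequentially)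
    show "\<forall>\<^sub>F n in sequentially. real n \<le> \<tau> (s n)"
      using \<tau>(1) seq_suble[OF w(1)] by (intro always_eventually allI) (meson of_nat_mono order_trans)
  qed
  have "(\<lambda>n. f (\<gamma> (\<tau> (s n)))) \<longlonglongrightarrow> \<xi>"
    using filterlim_compose[OF lim top] .
  moreover have "(\<lambda>n. f (\<gamma> (\<tau> (s n)))) \<longlonglongrightarrow> f w"
    using w(2) entire_imp_continuous_on[OF f(1), of UNIV]
    by (auto simp: continuous_on_eq_continuous_at o_def intro: isCont_tendsto_compose)
  ultimately have fw: "f w = \<xi>" by (metis LIMSEQ_unique)
  have "(\<gamma> \<longlongrightarrow> w) at_top"
    unfolding tendsto_iff
  proof (intro allI impI)
    fix e :: real assume "e > 0"
    obtain b where b: "f b - \<xi> \<noteq> 0"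
      using f(2) unfolding constant_on_def by auto
    have "(\<lambda>z. f z - \<xi>) holomorphic_on UNIV"
      using f(1) unfolding entire_def by (intro holomorphic_intros)
    then obtain \<rho>0 where \<rho>0: "\<rho>0 > 0" "\<And>z. z \<in> ball w \<rho>0 - {w} \<Longrightarrow> f z - \<xi> \<noteq> 0"
      using isolated_zeros[of "\<lambda>z. f z - \<xi>" UNIV w b] fw b connected_UNIV by auto
    define \<rho> where "\<rho> = min e \<rho>0 / 2"
    have \<rho>: "\<rho> > 0" "\<rho> < e" "\<rho> < \<rho>0" using \<rho>0(1) \<open>e > 0\<close> by (auto simp: \<rho>_def)
    have ne: "sphere w \<rho> \<noteq> {}" using \<rho>(1) by simp
    have "continuous_on (sphere w \<rho>) (\<lambda>z. norm (f z - \<xi>))"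
      by (intro continuous_intros entire_imp_continuous_on f(1))
    then obtain v where v: "v \<in> sphere w \<rho>" "\<And>z. z \<in> sphere w \<rho> \<Longrightarrow> norm (f v - \<xi>) \<le> norm (f z - \<xi>)"
      using continuous_attains_inf[OF compact_sphere ne] by blast
    have "v \<in> ball w \<rho>0 - {w}" using v(1) \<rho> by auto
    then have pos: "norm (f v - \<xi>) > 0" using \<rho>0(2) by simp
    then obtain T where T: "\<And>t. t \<ge> T \<Longrightarrow> dist (f (\<gamma> t)) \<xi> < norm (f v - \<xi>)"
      using lim unfolding tendsto_iff eventually_at_top_linorder by blast
    have "\<forall>\<^sub>F n in sequentially. \<tau> (s n) \<ge> max T 0"
      using top unfolding filterlim_at_top by blast
    moreover have "\<forall>\<^sub>F n in sequentially. dist (\<gamma> (\<tau> (s n))) w < \<rho>"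
      using w(2) \<rho>(1) unfolding tendsto_iff o_def by blast
    ultimately have "\<forall>\<^sub>F n in sequentially. \<tau> (s n) \<ge> max T 0 \<and> dist (\<gamma> (\<tau> (s n))) w < \<rho>"
      by (rule eventually_conj)
    then obtain t0 where t0: "t0 \<ge> max T 0" "dist (\<gamma> t0) w < \<rho>"
      unfolding eventually_sequentially by blast
    have "dist (\<gamma> t) w < \<rho>" if "t \<ge> t0" for t
    proof (rule ccontr)
      assume "\<not> dist (\<gamma> t) w < \<rho>"
      have "continuous_on {t0..t} (\<lambda>u. dist (\<gamma> u) w)"
        using t0(1) by (intro continuous_intros continuous_on_subset[OF \<gamma>]) auto
      then obtain u where u: "u \<ge> t0" "u \<le> t" "dist (\<gamma> u) w = \<rho>"
        using IVT'[of "\<lambda>u. dist (\<gamma> u) w" t0 \<rho> t] t0(2) \<open>\<not> dist (\<gamma> t) w < \<rho>\<close> \<open>t \<ge> t0\<close> by auto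
      then have "norm (f v - \<xi>) \<le> norm (f (\<gamma> u) - \<xi>)"
        by (intro v(2)) (simp add: dist_commute)
      moreover have "norm (f (\<gamma> u) - \<xi>) < norm (f v - \<xi>)"
        using T[of u] u t0 by (simp add: dist_norm)
      ultimately show False by simp
    qed
    then show "\<forall>\<^sub>F t in at_top. dist (\<gamma> t) w < e"
      unfolding eventually_at_top_linorder using \<rho>(2) by (intro exI[of _ t0]) (auto intro: less_trans)
  qed
  with fw show ?thesis by (rule that)
qed

lemma critical_asymptotic_subset:
  "critical_values f \<union> asymptotic_values f \<subseteq> singular_values f"
  unfolding singular_values_def by (rule closure_subset)

text \<open>
  For the asymptotic values: along an asymptotic path of \<open>f \<circ> g\<close>, the image under \<open>g\<close> either tends
  to \<open>\<infinity>\<close>, giving an asymptotic value of \<open>f\<close>, or it converges, giving one of \<open>g\<close>.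
\<close>

lemma singular_values_comp_subset:
  assumes f: "entire f" and g: "entire g" and cg: "\<not> f constant_on UNIV"
    and cpt: "compact (singular_values g)"
  shows "singular_values (f \<circ> g) \<subseteq> singular_values f \<union> f ` singular_values g"
proof -
  have cl: "closed (singular_values f \<union> f ` singular_values g)"
  proof (rule closed_Un)
    show "closed (singular_values f)" unfolding singular_values_def by (rule closed_closure)
    show "closed (f ` singular_values g)"
      using cpt by (intro compact_imp_closed compact_continuous_image entire_imp_continuous_on f)
  qed
  have d: "f field_differentiable at z" "g field_differentiable at z" for z
    using f g unfolding entire_def by (auto simp: holomorphic_on_def)
  have "critical_values (f \<circ> g) \<subseteq> critical_values f \<union> f ` critical_values g"
  proof
    fix y assume "y \<in> critical_values (f \<circ> g)"
    then obtain w where w: "y = f (g w)" "deriv (f \<circ> g) w = 0"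
      unfolding critical_values_def by auto
    have "deriv f (g w) * deriv g w = 0"
      using w(2) deriv_chain[OF d(2) d(1)] by simp
    then show "y \<in> critical_values f \<union> f ` critical_values g"
      unfolding critical_values_def using w(1) by auto
  qed
  moreover have "asymptotic_values (f \<circ> g) \<subseteq> asymptotic_values f \<union> f ` asymptotic_values g"
  proof
    fix y assume "y \<in> asymptotic_values (f \<circ> g)"
    then obtain \<gamma> :: "real \<Rightarrow> complex" where \<gamma>: "continuous_on {0..} \<gamma>"
      "filterlim \<gamma> at_infinity at_top" "((\<lambda>t. f (g (\<gamma> t))) \<longlongrightarrow> y) at_top"
      unfolding asymptotic_values_def by auto
    have cont: "continuous_on {0..} (\<lambda>t. g (\<gamma> t))"
      using continuous_on_compose[OF \<gamma>(1) entire_imp_continuous_on[OF g]] by (simp add: o_def)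
    show "y \<in> asymptotic_values f \<union> f ` asymptotic_values g"
    proof (cases "filterlim (\<lambda>t. g (\<gamma> t)) at_infinity at_top")
      case True
      then have "y \<in> asymptotic_values f"
        unfolding asymptotic_values_def using cont \<gamma>(3) by blast
      then show ?thesis by blast
    next
      case False
      obtain w where w: "f w = y" "((\<lambda>t. g (\<gamma> t)) \<longlongrightarrow> w) at_top"
        using entire_curve_limit_dichotomy[OF f cg cont \<gamma>(3) False] by blast
      have "w \<in> asymptotic_values g"
        unfolding asymptotic_values_def using \<gamma>(1,2) w(2) by blast
      then show ?thesis using w(1) by blast
    qed
  qed
  ultimately show ?thesis
    unfolding singular_values_def[of "f \<circ> g"]
    using critical_asymptotic_subset[of f] critical_asymptotic_subset[of g]
    by (intro closure_minimal[OF _ cl]) blast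
qed

text \<open>
  The last conclusion, that every solution near \<open>w\<close> is the one given by \<open>\<phi>\<close>, serves to recognise
  \<open>\<phi>\<close> as the continuation of a lift that is known on only one side of \<open>z1\<close>.
\<close>

lemma local_lift:
  assumes f: "entire f" and U: "open U" "z1 \<in> U" "k holomorphic_on U"
    and w: "f w = k z1" "deriv f w \<noteq> 0"
  obtains \<epsilon> \<rho> \<phi> where "\<epsilon> > 0" "\<rho> > 0" "ball z1 \<epsilon> \<subseteq> U" "\<phi> holomorphic_on ball z1 \<epsilon>" "\<phi> z1 = w"
    "\<And>z. z \<in> ball z1 \<epsilon> \<Longrightarrow> f (\<phi> z) = k z"
    "\<And>z u. z \<in> ball z1 \<epsilon> \<Longrightarrow> u \<in> ball w \<rho> \<Longrightarrow> f u = k z \<Longrightarrow> u = \<phi> z"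
proof -
  have hf: "f holomorphic_on UNIV" using f by (simp add: entire_def)
  obtain \<rho> where \<rho>: "\<rho> > 0" "open (f ` ball w \<rho>)" "inj_on f (ball w \<rho>)"
    using has_complex_derivative_locally_invertible[OF hf _ open_UNIV w(2)] by auto
  have hf': "f holomorphic_on ball w \<rho>" using hf holomorphic_on_subset by blast
  obtain b where b: "b holomorphic_on f ` ball w \<rho>" "\<And>z. z \<in> ball w \<rho> \<Longrightarrow> b (f z) = z"
    using holomorphic_has_inverse[OF hf' open_ball \<rho>(3)] by metis
  have "open (U \<inter> k -` (f ` ball w \<rho>))"
    using U \<rho>(2) by (intro continuous_open_preimage holomorphic_on_imp_continuous_on) auto
  moreover have "z1 \<in> U \<inter> k -` (f ` ball w \<rho>)"
    using U w(1) \<rho>(1) by (auto intro!: image_eqI[of _ _ w])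
  ultimately obtain \<epsilon> where \<epsilon>: "\<epsilon> > 0" "ball z1 \<epsilon> \<subseteq> U \<inter> k -` (f ` ball w \<rho>)"
    using open_contains_ball by blast
  show ?thesis
  proof (rule that[of \<epsilon> \<rho> "b \<circ> k"])
    show "b \<circ> k holomorphic_on ball z1 \<epsilon>"
      using \<epsilon>(2) U(3) b(1)
      by (intro holomorphic_on_compose_gen[of k _ b "f ` ball w \<rho>"]) (auto intro: holomorphic_on_subset)
    show "(b \<circ> k) z1 = w" using b(2)[of w] \<rho>(1) w(1) by simp
    show "f ((b \<circ> k) z) = k z" if "z \<in> ball z1 \<epsilon>" for z
    proof -
      have "k z \<in> f ` ball w \<rho>" using \<epsilon>(2) that by blast
      then obtain u where "u \<in> ball w \<rho>" "k z = f u" by blast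
      then show ?thesis using b(2) by simp
    qed
    show "u = (b \<circ> k) z" if "z \<in> ball z1 \<epsilon>" "u \<in> ball w \<rho>" "f u = k z" for z u
      using b(2)[OF that(2)] that(3) by simp
  qed (use \<epsilon> \<rho> in auto)
qed

lemma lift_unique:
  assumes f: "entire f" and A: "open A" "connected A"
    and hol: "\<phi> holomorphic_on A" "\<psi> holomorphic_on A"
    and lift: "\<And>z. z \<in> A \<Longrightarrow> f (\<phi> z) = f (\<psi> z)"
    and p: "p \<in> A" "\<phi> p = \<psi> p" "deriv f (\<phi> p) \<noteq> 0"
    and z: "z \<in> A"
  shows "\<phi> z = \<psi> z"
proof -
  have hf: "f holomorphic_on UNIV" using f by (simp add: entire_def)
  obtain \<rho> where \<rho>: "\<rho> > 0" "inj_on f (ball (\<phi> p) \<rho>)"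
    using has_complex_derivative_locally_invertible[OF hf _ open_UNIV p(3)] by auto
  define V where "V = (A \<inter> \<phi> -` ball (\<phi> p) \<rho>) \<inter> (A \<inter> \<psi> -` ball (\<phi> p) \<rho>)"
  have "open V" unfolding V_def
    by (intro open_Int continuous_open_preimage holomorphic_on_imp_continuous_on hol A) auto
  moreover have "p \<in> V" using p \<rho>(1) by (simp add: V_def)
  moreover have "\<phi> v = \<psi> v" if "v \<in> V" for v
    using that \<rho>(2) lift unfolding V_def inj_on_def by blast
  ultimately show ?thesis
    using analytic_continuation_open[of V A \<phi> \<psi> z] A hol z unfolding V_def by blast
qed

definition is_lift ::
  "(complex \<Rightarrow> complex) \<Rightarrow> (complex \<Rightarrow> complex) \<Rightarrow> complex set \<Rightarrow> (complex \<Rightarrow> complex) \<Rightarrow> bool" where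
  "is_lift f k A \<phi> \<longleftrightarrow> \<phi> holomorphic_on A \<and> (\<forall>z\<in>A. f (\<phi> z) = k z)"

lemma is_lift_subset: "is_lift f k A \<phi> \<Longrightarrow> B \<subseteq> A \<Longrightarrow> is_lift f k B \<phi>"
  unfolding is_lift_def using holomorphic_on_subset by blast

lemma regular_point:
  assumes "f w \<notin> singular_values f"
  shows "deriv f w \<noteq> 0"
proof
  assume "deriv f w = 0"
  then have "f w \<in> critical_values f" unfolding critical_values_def by blast
  then show False
    using assms critical_asymptotic_subset[of f] by blast
qed

text \<open>
  Off the singular values \<open>f\<close> is locally injective along any lift, so two lifts that agree at one
  point agree near it, and hence on the connected set \<open>A\<close>.
\<close>

lemma is_lift_unique:
  assumes "entire f" "open A" "connected A" "is_lift f k A \<phi>" "is_lift f k A \<psi>"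
    and "\<And>z. z \<in> A \<Longrightarrow> k z \<notin> singular_values f" "p \<in> A" "\<phi> p = \<psi> p" "z \<in> A"
  shows "\<phi> z = \<psi> z"
proof (rule lift_unique[OF assms(1-3), where p = p and \<phi> = \<phi> and \<psi> = \<psi>])
  show "deriv f (\<phi> p) \<noteq> 0"
    using assms by (intro regular_point) (auto simp: is_lift_def)
qed (use assms in \<open>auto simp: is_lift_def\<close>)

lemma is_lift_locally:
  assumes "\<And>z. z \<in> A \<Longrightarrow> \<exists>N \<psi>. open N \<and> z \<in> N \<and> is_lift f k N \<psi> \<and> (\<forall>v\<in>N. \<phi> v = \<psi> v)"
  shows "is_lift f k A \<phi>"
  unfolding is_lift_def
proof
  show "\<phi> holomorphic_on A"
    unfolding holomorphic_on_def
  proof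
    fix z assume "z \<in> A"
    then obtain N \<psi> where N: "open N" "z \<in> N" "is_lift f k N \<psi>" "\<forall>v\<in>N. \<phi> v = \<psi> v"
      using assms by blast
    then have "\<phi> holomorphic_on N"
      unfolding is_lift_def by (metis holomorphic_cong)
    then show "\<phi> field_differentiable at z within A"
      using N(1,2) holomorphic_on_imp_differentiable_at field_differentiable_at_within by blast
  qed
  show "\<forall>z\<in>A. f (\<phi> z) = k z"
    using assms unfolding is_lift_def by metis
qed

text \<open>
  Follow the lift along the radius towards \<open>\<zeta>\<close>.  It cannot tend to \<open>\<infinity>\<close>, for \<open>k \<zeta>\<close> would be an
  asymptotic value; so it has a finite limit \<open>w\<close>, which is not a critical point, and the local inverse
  of \<open>f\<close> at \<open>w\<close> continues it.
\<close>

lemma lift_extends_at_boundary: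
  assumes f: "entire f" "\<not> f constant_on UNIV"
    and k: "k holomorphic_on ball c R" "\<And>z. z \<in> ball c R \<Longrightarrow> k z \<notin> singular_values f"
    and r: "0 < r" "r < R" and \<Phi>: "is_lift f k (ball c r) \<Phi>"
    and \<zeta>: "\<zeta> \<in> sphere c r"
  obtains \<epsilon> \<phi> where "\<epsilon> > 0" "ball \<zeta> \<epsilon> \<subseteq> ball c R" "is_lift f k (ball \<zeta> \<epsilon>) \<phi>"
    "\<forall>z\<in>ball \<zeta> \<epsilon> \<inter> ball c r. \<phi> z = \<Phi> z"
proof -
  \<comment> \<open>the radius from \<open>c\<close> to \<open>\<zeta>\<close>, parametrised by \<open>{0..}\<close> as an asymptotic path must be\<close>
  define p where "p t = c + of_real (1 - inverse (1 + t)) * (\<zeta> - c)" for t :: real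
  have \<zeta>R: "\<zeta> \<in> ball c R" and n\<zeta>: "norm (\<zeta> - c) = r"
    using \<zeta> r by (auto simp: dist_norm norm_minus_commute)
  have pin: "p t \<in> ball c r" if "t \<ge> 0" for t
  proof -
    have "norm (p t - c) = \<bar>1 - inverse (1 + t)\<bar> * r"
      unfolding p_def using n\<zeta> by (simp only: add_diff_cancel_left' norm_mult norm_of_real)
    also have "\<bar>1 - inverse (1 + t)\<bar> = t / (1 + t)"
      using that by (simp add: field_simps)
    also have "t / (1 + t) * r < 1 * r"
      using that r(1) by (intro mult_strict_right_mono) auto
    finally show ?thesis by (simp add: dist_norm norm_minus_commute)
  qed
  have contp: "continuous_on {0..} p"
    unfolding p_def by (intro continuous_intros) auto
  have "((\<lambda>t::real. inverse (1 + t)) \<longlongrightarrow> 0) at_top"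
    by (intro tendsto_inverse_0_at_top filterlim_tendsto_add_at_top[OF tendsto_const] filterlim_ident)
  then have "((\<lambda>t::real. 1 - inverse (1 + t)) \<longlongrightarrow> 1 - 0) at_top"
    by (intro tendsto_diff tendsto_const)
  then have "(p \<longlongrightarrow> c + of_real (1 - 0) * (\<zeta> - c)) at_top"
    unfolding p_def by (intro tendsto_add tendsto_mult tendsto_const tendsto_of_real)
  then have limp: "(p \<longlongrightarrow> \<zeta>) at_top" by simp
  have cont: "continuous_on {0..} (\<lambda>t. \<Phi> (p t))"
    using \<Phi> pin
    by (intro continuous_on_compose2[OF _ contp, of "ball c r" \<Phi>])
       (auto simp: is_lift_def intro: holomorphic_on_imp_continuous_on)
  have "isCont k \<zeta>"
    using continuous_on_eq_continuous_at[OF open_ball] holomorphic_on_imp_continuous_on[OF k(1)] \<zeta>R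
    by blast
  then have "((\<lambda>t. k (p t)) \<longlongrightarrow> k \<zeta>) at_top"
    using limp isCont_tendsto_compose by blast
  moreover have "\<forall>\<^sub>F t in at_top. k (p t) = f (\<Phi> (p t))"
    using \<Phi> pin unfolding is_lift_def eventually_at_top_linorder by force
  ultimately have lim: "((\<lambda>t. f (\<Phi> (p t))) \<longlongrightarrow> k \<zeta>) at_top"
    by (simp add: tendsto_cong)
  have "\<not> filterlim (\<lambda>t. \<Phi> (p t)) at_infinity at_top"
  proof
    assume "filterlim (\<lambda>t. \<Phi> (p t)) at_infinity at_top"
    then have "k \<zeta> \<in> asymptotic_values f"
      unfolding asymptotic_values_def using lim cont by blast
    then show False
      using k(2)[OF \<zeta>R] critical_asymptotic_subset[of f] by blast
  qed
  then obtain w where w: "f w = k \<zeta>" "((\<lambda>t. \<Phi> (p t)) \<longlongrightarrow> w) at_top"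
    using entire_curve_limit_dichotomy[OF f cont lim] by blast
  have dw: "deriv f w \<noteq> 0" using k(2)[OF \<zeta>R] w(1) by (intro regular_point) simp
  obtain \<epsilon> \<rho> \<phi> where \<epsilon>: "\<epsilon> > 0" "\<rho> > 0" "ball \<zeta> \<epsilon> \<subseteq> ball c R" "\<phi> holomorphic_on ball \<zeta> \<epsilon>"
    "\<phi> \<zeta> = w" "\<And>z. z \<in> ball \<zeta> \<epsilon> \<Longrightarrow> f (\<phi> z) = k z"
    "\<And>z u. z \<in> ball \<zeta> \<epsilon> \<Longrightarrow> u \<in> ball w \<rho> \<Longrightarrow> f u = k z \<Longrightarrow> u = \<phi> z"
    using that by (rule local_lift[OF f(1) open_ball \<zeta>R k(1) w(1) dw])
  have lift: "is_lift f k (ball \<zeta> \<epsilon>) \<phi>" using \<epsilon> by (simp add: is_lift_def)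
  have "\<forall>\<^sub>F t in at_top. dist (p t) \<zeta> < \<epsilon> \<and> dist (\<Phi> (p t)) w < \<rho> \<and> t \<ge> 0"
    using limp w(2) \<epsilon>(1,2) unfolding tendsto_iff
    by (intro eventually_conj eventually_ge_at_top) auto
  then obtain t where t: "dist (p t) \<zeta> < \<epsilon>" "dist (\<Phi> (p t)) w < \<rho>" "t \<ge> 0"
    unfolding eventually_at_top_linorder by blast
  then have pt: "p t \<in> ball \<zeta> \<epsilon> \<inter> ball c r" using pin by (simp add: dist_commute)
  have "\<Phi> (p t) = \<phi> (p t)"
    using pt t(2) \<Phi> by (intro \<epsilon>(7)) (auto simp: is_lift_def dist_commute)
  have "\<phi> z = \<Phi> z" if "z \<in> ball \<zeta> \<epsilon> \<inter> ball c r" for z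
  proof (rule is_lift_unique[OF f(1), of "ball \<zeta> \<epsilon> \<inter> ball c r" k \<phi> \<Phi> "p t"])
    show "connected (ball \<zeta> \<epsilon> \<inter> ball c r)"
      by (intro convex_connected convex_Int convex_ball)
    show "is_lift f k (ball \<zeta> \<epsilon> \<inter> ball c r) \<phi>" "is_lift f k (ball \<zeta> \<epsilon> \<inter> ball c r) \<Phi>"
      using lift \<Phi> by (auto intro: is_lift_subset)
    show "k u \<notin> singular_values f" if "u \<in> ball \<zeta> \<epsilon> \<inter> ball c r" for u
      using that \<epsilon>(3) k(2) by blast
  qed (use pt \<open>\<Phi> (p t) = \<phi> (p t)\<close> that in auto)
  then show ?thesis using that \<epsilon>(1,3) lift by blast
qed

text \<open>
  Heine-Borel makes the size of the local continuations uniform along the circle.  They are glued by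
  using at \<open>z\<close> the continuation that belongs to the radial projection of \<open>z\<close> to the circle.
\<close>

lemma lift_extends:
  assumes f: "entire f" "\<not> f constant_on UNIV"
    and k: "k holomorphic_on ball c R" "\<And>z. z \<in> ball c R \<Longrightarrow> k z \<notin> singular_values f"
    and r: "0 < r" "r < R" and \<Phi>: "is_lift f k (ball c r) \<Phi>"
  obtains r' \<Psi> where "r < r'" "r' \<le> R" "is_lift f k (ball c r') \<Psi>" "\<Psi> c = \<Phi> c"
proof -
  define G where "G = {B. \<exists>\<phi>. open B \<and> B \<subseteq> ball c R \<and> is_lift f k B \<phi> \<and> (\<forall>z\<in>B \<inter> ball c r. \<phi> z = \<Phi> z)}"
  have "sphere c r \<subseteq> \<Union>G"
  proof
    fix \<zeta> assume \<zeta>: "\<zeta> \<in> sphere c r"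
    obtain \<epsilon> \<phi> where "\<epsilon> > 0" "ball \<zeta> \<epsilon> \<subseteq> ball c R" "is_lift f k (ball \<zeta> \<epsilon>) \<phi>"
      "\<forall>z\<in>ball \<zeta> \<epsilon> \<inter> ball c r. \<phi> z = \<Phi> z"
      by (rule lift_extends_at_boundary[OF f k r \<Phi> \<zeta>]) blast
    then have "ball \<zeta> \<epsilon> \<in> G" "\<zeta> \<in> ball \<zeta> \<epsilon>" unfolding G_def by auto
    then show "\<zeta> \<in> \<Union>G" by blast
  qed
  obtain \<delta> where \<delta>: "\<delta> > 0" "\<And>\<zeta>. \<zeta> \<in> sphere c r \<Longrightarrow> \<exists>B\<in>G. ball \<zeta> \<delta> \<subseteq> B"
  proof (rule Heine_Borel_lemma[of "sphere c r" G])
    show "open B" if "B \<in> G" for B using that unfolding G_def by blast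
  qed (use \<open>sphere c r \<subseteq> \<Union>G\<close> in auto)
  have "\<exists>\<phi>. ball \<zeta> \<delta> \<subseteq> ball c R \<and> is_lift f k (ball \<zeta> \<delta>) \<phi> \<and> (\<forall>z\<in>ball \<zeta> \<delta> \<inter> ball c r. \<phi> z = \<Phi> z)"
    if \<zeta>: "\<zeta> \<in> sphere c r" for \<zeta>
  proof -
    obtain B \<phi> where B: "ball \<zeta> \<delta> \<subseteq> B" "B \<subseteq> ball c R" "is_lift f k B \<phi>"
      "\<forall>z\<in>B \<inter> ball c r. \<phi> z = \<Phi> z"
      using \<delta>(2)[OF \<zeta>] unfolding G_def by auto
    show ?thesis
    proof (intro exI[of _ \<phi>] conjI)
      show "is_lift f k (ball \<zeta> \<delta>) \<phi>" by (rule is_lift_subset[OF B(3,1)])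
    qed (use B in auto)
  qed
  then obtain \<phi> where \<phi>R: "\<And>\<zeta>. \<zeta> \<in> sphere c r \<Longrightarrow> ball \<zeta> \<delta> \<subseteq> ball c R"
    and \<phi>: "\<And>\<zeta>. \<zeta> \<in> sphere c r \<Longrightarrow> is_lift f k (ball \<zeta> \<delta>) (\<phi> \<zeta>)"
    and \<phi>\<Phi>: "\<And>\<zeta> z. \<zeta> \<in> sphere c r \<Longrightarrow> z \<in> ball \<zeta> \<delta> \<Longrightarrow> z \<in> ball c r \<Longrightarrow> \<phi> \<zeta> z = \<Phi> z"
    by (metis IntI)
  have agree: "\<phi> \<zeta> z = \<phi> \<zeta>' z"
    if "\<zeta> \<in> sphere c r" "\<zeta>' \<in> sphere c r" "z \<in> ball \<zeta> \<delta>" "z \<in> ball \<zeta>' \<delta>" for \<zeta> \<zeta>' z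
  proof -
    \<comment> \<open>Both continuations equal \<open>\<Phi>\<close> where their discs meet \<open>ball c r\<close>.  There is such a point,
      as the midpoint of the two centres lies in both discs and in \<open>cball c r\<close>.\<close>
    define m where "m = midpoint \<zeta> \<zeta>'"
    have "dist \<zeta> \<zeta>' < 2 * \<delta>"
      using that(3,4) dist_triangle_less_add[of \<zeta> z \<delta> \<zeta>' \<delta>] by (simp add: dist_commute)
    then have "m \<in> ball \<zeta> \<delta> \<inter> ball \<zeta>' \<delta>"
      unfolding m_def by (simp add: dist_midpoint)
    moreover have "m \<in> cball c r"
    proof -
      have "m \<in> closed_segment \<zeta> \<zeta>'" unfolding m_def by simp
      then show ?thesis
        using closed_segment_subset[OF _ _ convex_cball, of \<zeta> c r \<zeta>'] that(1,2) by auto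
    qed
    then have "m \<in> closure (ball c r)" using r(1) by simp
    ultimately have "ball \<zeta> \<delta> \<inter> ball \<zeta>' \<delta> \<inter> ball c r \<noteq> {}"
      using open_Int_closure_eq_empty[OF open_Int[OF open_ball open_ball], of \<zeta> \<delta> \<zeta>' \<delta> "ball c r"]
      by blast
    then obtain p where p: "p \<in> ball \<zeta> \<delta> \<inter> ball \<zeta>' \<delta>" "p \<in> ball c r" by blast
    show ?thesis
    proof (rule is_lift_unique[OF f(1), of "ball \<zeta> \<delta> \<inter> ball \<zeta>' \<delta>" k "\<phi> \<zeta>" "\<phi> \<zeta>'" p])
      show "connected (ball \<zeta> \<delta> \<inter> ball \<zeta>' \<delta>)"
        by (intro convex_connected convex_Int convex_ball)
      show "is_lift f k (ball \<zeta> \<delta> \<inter> ball \<zeta>' \<delta>) (\<phi> \<zeta>)" "is_lift f k (ball \<zeta> \<delta> \<inter> ball \<zeta>' \<delta>) (\<phi> \<zeta>')"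
        using \<phi> that by (auto intro: is_lift_subset)
      show "k u \<notin> singular_values f" if "u \<in> ball \<zeta> \<delta> \<inter> ball \<zeta>' \<delta>" for u
        using that \<phi>R \<open>\<zeta> \<in> sphere c r\<close> k(2) by blast
    qed (use p that \<phi>\<Phi> in auto)
  qed
  define \<pi> where "\<pi> z = c + of_real (r / norm (z - c)) * (z - c)" for z
  define \<Psi> where "\<Psi> z = (if z \<in> ball c r then \<Phi> z else \<phi> (\<pi> z) z)" for z
  have \<pi>: "\<pi> z \<in> sphere c r" "z \<in> ball (\<pi> z) \<delta>" if "z \<in> ball c (r + \<delta>)" "z \<notin> ball c r" for z
  proof -
    have n: "norm (z - c) \<ge> r" "norm (z - c) < r + \<delta>"
      using that by (auto simp: dist_norm norm_minus_commute)
    then show "\<pi> z \<in> sphere c r"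
      using r(1) by (auto simp: \<pi>_def dist_norm norm_mult norm_divide)
    have "z - \<pi> z = of_real (1 - r / norm (z - c)) * (z - c)"
      by (simp add: \<pi>_def algebra_simps)
    then have "norm (z - \<pi> z) = \<bar>1 - r / norm (z - c)\<bar> * norm (z - c)"
      by (metis norm_mult norm_of_real)
    also have "\<dots> = norm (z - c) - r"
      using n(1) r(1) by (cases "z = c") (auto simp: field_simps abs_if)
    finally show "z \<in> ball (\<pi> z) \<delta>"
      using n(2) by (simp add: dist_norm norm_minus_commute)
  qed
  have "is_lift f k (ball c (r + \<delta>)) \<Psi>"
  proof (rule is_lift_locally)
    fix z assume z: "z \<in> ball c (r + \<delta>)"
    show "\<exists>N \<psi>. open N \<and> z \<in> N \<and> is_lift f k N \<psi> \<and> (\<forall>v\<in>N. \<Psi> v = \<psi> v)"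
    proof (cases "z \<in> ball c r")
      case True
      then show ?thesis
        using \<Phi> by (intro exI[of _ "ball c r"] exI[of _ \<Phi>]) (simp add: \<Psi>_def)
    next
      case False
      define N where "N = ball (\<pi> z) \<delta> \<inter> ball c (r + \<delta>)"
      have "\<Psi> v = \<phi> (\<pi> z) v" if "v \<in> N" for v
        using that \<phi>\<Phi>[OF \<pi>(1)[OF z False], of v] agree[of "\<pi> z" "\<pi> v" v] \<pi>[of v] \<pi>[OF z False]
        unfolding N_def \<Psi>_def by auto
      moreover have "z \<in> N" "open N" using \<pi>[OF z False] z by (auto simp: N_def)
      moreover have "is_lift f k N (\<phi> (\<pi> z))"
        using \<phi>[OF \<pi>(1)[OF z False]] by (rule is_lift_subset) (simp add: N_def)
      ultimately show ?thesis by blast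
    qed
  qed
  then have "is_lift f k (ball c (min (r + \<delta>) R)) \<Psi>"
    by (rule is_lift_subset) auto
  then show ?thesis
    using that[of "min (r + \<delta>) R" \<Psi>] r \<delta>(1) by (auto simp: \<Psi>_def)
qed

text \<open>
  The monodromy theorem for the unramified map that \<open>f\<close> induces over the complement of its singular
  values: the supremum of the radii of discs to which the local lift extends is attained by
  uniqueness, and by \<open>lift_extends\<close> it cannot be less than \<open>R\<close>.
\<close>

lemma lift_exists:
  assumes f: "entire f" "\<not> f constant_on UNIV"
    and k: "k holomorphic_on ball c R" "\<And>z. z \<in> ball c R \<Longrightarrow> k z \<notin> singular_values f"
    and R: "0 < R" and w0: "f w0 = k c"
  obtains \<phi> where "is_lift f k (ball c R) \<phi>" "\<phi> c = w0"
proof -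
  define E where "E = {r. 0 < r \<and> r \<le> R \<and> (\<exists>\<phi>. is_lift f k (ball c r) \<phi> \<and> \<phi> c = w0)}"
  have cR: "c \<in> ball c R" using R by simp
  have "deriv f w0 \<noteq> 0" using k(2)[OF cR] w0 by (intro regular_point) simp
  then obtain \<epsilon> \<phi>0 where \<epsilon>: "\<epsilon> > 0" "ball c \<epsilon> \<subseteq> ball c R" "\<phi>0 holomorphic_on ball c \<epsilon>" "\<phi>0 c = w0"
    "\<forall>z\<in>ball c \<epsilon>. f (\<phi>0 z) = k z"
    by (rule local_lift[OF f(1) open_ball cR k(1) w0]) blast
  then have "\<epsilon> \<in> E" 
    using R unfolding E_def is_lift_def by (auto simp: ball_subset_ball_iff)
  have bdd: "bdd_above E" unfolding E_def bdd_above_def by blast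
  define s where "s = Sup E"
  have "\<epsilon> \<le> s" unfolding s_def by (rule cSup_upper[OF \<open>\<epsilon> \<in> E\<close> bdd])
  moreover have "s \<le> R"
    unfolding s_def using \<open>\<epsilon> \<in> E\<close> by (intro cSup_least) (auto simp: E_def)
  ultimately have s: "0 < s" "s \<le> R" using \<epsilon>(1) by auto
  have "\<exists>\<phi>. is_lift f k (ball c r) \<phi> \<and> \<phi> c = w0" if "r \<in> E" for r
    using that unfolding E_def by blast
  then obtain \<phi> where \<phi>: "\<And>r. r \<in> E \<Longrightarrow> is_lift f k (ball c r) (\<phi> r)" "\<And>r. r \<in> E \<Longrightarrow> \<phi> r c = w0"
    by metis
  have agree: "\<phi> r z = \<phi> t z" if "r \<in> E" "t \<in> E" "z \<in> ball c r" "z \<in> ball c t" for r t z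
  proof (rule is_lift_unique[OF f(1), of "ball c (min r t)" k "\<phi> r" "\<phi> t" c])
    show "is_lift f k (ball c (min r t)) (\<phi> r)" "is_lift f k (ball c (min r t)) (\<phi> t)"
      using \<phi>(1)[OF that(1)] \<phi>(1)[OF that(2)] by (auto intro: is_lift_subset)
    show "k u \<notin> singular_values f" if "u \<in> ball c (min r t)" for u
      using that \<open>r \<in> E\<close> by (intro k(2)) (auto simp: E_def)
  qed (use that \<phi>(2) in \<open>auto simp: E_def\<close>)
  define \<rho> where "\<rho> z = (SOME r. r \<in> E \<and> z \<in> ball c r)" for z
  have \<rho>: "\<rho> z \<in> E \<and> z \<in> ball c (\<rho> z)" if "z \<in> ball c s" for z
  proof -
    have "\<exists>r\<in>E. dist c z < r"
      using that less_cSup_iff[of E "dist c z"] bdd \<open>\<epsilon> \<in> E\<close> unfolding s_def by auto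
    then have "\<exists>r. r \<in> E \<and> z \<in> ball c r" by auto
    then show ?thesis unfolding \<rho>_def by (rule someI_ex)
  qed
  define \<Phi> where "\<Phi> z = \<phi> (\<rho> z) z" for z
  have \<Phi>: "is_lift f k (ball c s) \<Phi>"
  proof (rule is_lift_locally)
    fix z assume z: "z \<in> ball c s"
    have "\<Phi> v = \<phi> (\<rho> z) v" if "v \<in> ball c (\<rho> z) \<inter> ball c s" for v
      unfolding \<Phi>_def using that \<rho>[of v] \<rho>[OF z] by (intro agree) auto
    then show "\<exists>N \<psi>. open N \<and> z \<in> N \<and> is_lift f k N \<psi> \<and> (\<forall>v\<in>N. \<Phi> v = \<psi> v)"
      using \<rho>[OF z] z \<phi>(1)[of "\<rho> z"]
      by (intro exI[of _ "ball c (\<rho> z) \<inter> ball c s"] exI[of _ "\<phi> (\<rho> z)"]) (auto intro: is_lift_subset)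
  qed
  have \<Phi>c: "\<Phi> c = w0" using \<rho>[of c] \<phi>(2) s(1) by (simp add: \<Phi>_def)
  have "s = R"
  proof (rule ccontr)
    assume "s \<noteq> R"
    then have "s < R" using s by simp
    then obtain r' \<Psi> where r': "s < r'" "r' \<le> R" "is_lift f k (ball c r') \<Psi>" "\<Psi> c = \<Phi> c"
      using lift_extends[OF f k s(1) _ \<Phi>] by blast
    then have "r' \<in> E" unfolding E_def using s(1) \<Phi>c by auto
    then show False using cSup_upper[OF _ bdd] r'(1) unfolding s_def by fastforce
  qed
  then show ?thesis using that \<Phi> \<Phi>c by blast
qed

text \<open>
  Lift through one factor \<open>f\<close> at a time; forward invariance of the postsingular set keeps every
  intermediate lift away from it.
\<close>

lemma lift_exists_funpow:
  assumes f: "entire f" "\<not> f constant_on UNIV" and R: "0 < R"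
    and "k holomorphic_on ball c R" "\<And>z. z \<in> ball c R \<Longrightarrow> k z \<notin> postsingular_set f"
    and "(f ^^ n) w0 = k c"
  shows "\<exists>\<phi>. is_lift (f ^^ n) k (ball c R) \<phi> \<and> \<phi> c = w0"
  using assms(4-6)
proof (induction n arbitrary: k)
  case 0
  then show ?case by (intro exI[of _ k]) (auto simp: is_lift_def)
next
  case (Suc n)
  have "f ((f ^^ n) w0) = k c" using Suc.prems(3) by simp
  moreover have "k z \<notin> singular_values f" if "z \<in> ball c R" for z
    using Suc.prems(2)[OF that] singular_subset_postsingular by blast
  ultimately obtain k1 where k1: "is_lift f k (ball c R) k1" "k1 c = (f ^^ n) w0"
    using lift_exists[OF f Suc.prems(1) _ R] by blast
  have "k1 z \<notin> postsingular_set f" if "z \<in> ball c R" for z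
    using postsingular_invariant[OF f(1), of "k1 z" 1] k1(1) that Suc.prems(2)
    by (auto simp: is_lift_def)
  then obtain \<phi> where "is_lift (f ^^ n) k1 (ball c R) \<phi>" "\<phi> c = w0"
    using Suc.IH[of k1] k1 unfolding is_lift_def by metis
  then show ?case
    using k1(1) by (intro exI[of _ \<phi>]) (auto simp: is_lift_def)
qed

section \<open>Unbounded orbits of transcendental entire functions\<close>

lemma linear_if_linear_growth_along_radii:
  assumes f: "entire f"
    and bound: "\<And>T. \<exists>R\<ge>T. \<forall>z. norm z \<le> R / 2 \<longrightarrow> norm (f z) \<le> C * R"
  shows "f z = poly [:f 0, deriv f 0:] z"
proof -
  have hf: "f holomorphic_on A" for A using f unfolding entire_def using holomorphic_on_subset by blast
  have zero: "(deriv ^^ n) f 0 = 0" if n: "n \<ge> 2" for n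
  proof -
    define D where "D = fact n * 2 ^ n * (\<bar>C\<bar> + 1)"
    have est: "\<exists>R\<ge>T. norm ((deriv ^^ n) f 0) \<le> D / R" if "T \<ge> 1" for T
    proof -
      obtain R where R: "R \<ge> T" "\<And>z. norm z \<le> R / 2 \<Longrightarrow> norm (f z) \<le> C * R"
        using bound by blast
      have R1: "R \<ge> 1" using R(1) that by simp
      have "norm ((deriv ^^ n) f 0) \<le> fact n * ((\<bar>C\<bar> + 1) * R) / (R / 2) ^ n"
      proof (rule Cauchy_higher_deriv_bound[where y = 0])
        show "continuous_on (cball 0 (R / 2)) f" by (rule entire_imp_continuous_on[OF f])
        fix w :: complex assume "w \<in> ball 0 (R / 2)"
        then have "norm (f w) \<le> C * R" by (intro R(2)) simp
        also have "\<dots> < (\<bar>C\<bar> + 1) * R" using R1 by (intro mult_strict_right_mono) auto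
        finally show "f w \<in> ball 0 ((\<bar>C\<bar> + 1) * R)" by simp
      qed (use hf R1 n in auto)
      also have "\<dots> = D * (R / R ^ n)"
        by (simp add: D_def power_divide field_simps)
      also have "\<dots> \<le> D * (1 / R)"
      proof (rule mult_left_mono)
        have "R * R \<le> R ^ n"
          using power_increasing[OF n R1] by (simp add: power2_eq_square)
        then show "R / R ^ n \<le> 1 / R"
          using R1 by (simp add: field_simps)
      qed (simp add: D_def)
      finally show ?thesis using R(1) by auto
    qed
    show ?thesis
    proof (rule ccontr)
      assume "(deriv ^^ n) f 0 \<noteq> 0"
      then have p: "norm ((deriv ^^ n) f 0) > 0" by simp
      obtain R where R: "R \<ge> max 1 (D / norm ((deriv ^^ n) f 0) + 1)" "norm ((deriv ^^ n) f 0) \<le> D / R"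
        using est[of "max 1 (D / norm ((deriv ^^ n) f 0) + 1)"] by auto
      then have "norm ((deriv ^^ n) f 0) * R \<le> D" by (simp add: field_simps)
      moreover have "D + norm ((deriv ^^ n) f 0) \<le> norm ((deriv ^^ n) f 0) * R"
        using R(1) p by (simp add: field_simps)
      ultimately show False using p by linarith
    qed
  qed
  have "(\<lambda>n. (deriv ^^ n) f 0 / fact n * (z - 0) ^ n) sums f z"
    by (rule holomorphic_power_series[of f 0 "norm z + 1"]) (use hf in auto)
  moreover have "(\<lambda>n. (deriv ^^ n) f 0 / fact n * (z - 0) ^ n) sums
      (\<Sum>n\<in>{0,1}. (deriv ^^ n) f 0 / fact n * (z - 0) ^ n)"
    by (rule sums_finite) (use zero in \<open>auto simp: not_less_eq_eq\<close>)
  ultimately have "f z = (\<Sum>n\<in>{0,1}. (deriv ^^ n) f 0 / fact n * (z - 0) ^ n)"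
    by (rule sums_unique2)
  then show ?thesis by simp
qed

text \<open>
  Schottky's theorem rescaled from the unit disc and from the omitted values \<open>0\<close> and \<open>1\<close>.
\<close>

lemma Schottky_two_values:
  assumes \<phi>: "\<phi> holomorphic_on cball w0 R" and R: "0 < R" and ab: "a \<noteq> b"
    and omit: "\<And>z. z \<in> cball w0 R \<Longrightarrow> \<phi> z \<noteq> a \<and> \<phi> z \<noteq> b"
    and r: "norm (\<phi> w0 - a) \<le> r * norm (b - a)" and z: "z \<in> cball w0 (R / 2)"
  shows "norm (\<phi> z - a) \<le> exp (pi * exp (pi * (2 + 2 * r + 12))) * norm (b - a)"
proof -
  have ne: "b - a \<noteq> 0" using ab by simp
  define h where "h u = (\<phi> (w0 + of_real R * u) - a) / (b - a)" for u
  have in_ball: "w0 + of_real R * u \<in> cball w0 R" if "u \<in> cball 0 1" for u :: complex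
    using that R by (simp add: dist_norm norm_mult mult_left_le)
  have hol: "h holomorphic_on cball 0 1"
  proof -
    have "(\<phi> \<circ> (\<lambda>u. w0 + of_real R * u)) holomorphic_on cball 0 1"
      by (rule holomorphic_on_compose_gen[OF _ \<phi>]) (use in_ball in \<open>auto intro!: holomorphic_intros\<close>)
    then show ?thesis
      unfolding h_def o_def using ne by (intro holomorphic_intros) auto
  qed
  have h01: "\<not> (h u = 0 \<or> h u = 1)" if "u \<in> cball 0 1" for u
    using omit[OF in_ball[OF that]] ne by (auto simp: h_def)
  have h0: "norm (h 0) \<le> r"
    using r ne by (simp add: h_def norm_divide divide_simps)
  define u where "u = (z - w0) / of_real R"
  have u: "norm u \<le> 1/2" "w0 + of_real R * u = z"
    using z R by (auto simp: u_def norm_divide field_simps dist_norm norm_minus_commute)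
  have "norm (h u) \<le> exp (pi * exp (pi * (2 + 2 * r + 12 * (1/2) / (1 - 1/2))))"
    by (rule Schottky[OF hol h0 h01]) (use u in auto)
  then show ?thesis
    using ne u(2) by (simp add: h_def norm_divide divide_simps)
qed

text \<open>
  Otherwise, for arbitrarily large \<open>R\<close>, the function omits on \<open>cball 0 R\<close> a value of modulus \<open>2 * R\<close>
  and a value of modulus \<open>4 * R\<close>.  Schottky's theorem then bounds it linearly in \<open>R\<close> on the
  disc of radius \<open>R / 2\<close>, so that it is affine.
\<close>

lemma transcendental_image_contains_circle:
  assumes "transcendental_entire f"
  obtains R0 where "R0 \<ge> 1"
    "\<And>R. R \<ge> R0 \<Longrightarrow> sphere 0 (2 * R) \<subseteq> f ` cball 0 R \<or> sphere 0 (4 * R) \<subseteq> f ` cball 0 R"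
proof -
  have f: "entire f" using assms by (simp add: transcendental_entire_def)
  have "\<exists>T. \<forall>R\<ge>T. sphere 0 (2 * R) \<subseteq> f ` cball 0 R \<or> sphere 0 (4 * R) \<subseteq> f ` cball 0 R"
  proof (rule ccontr)
    assume "\<not> ?thesis"
    then have bad: "\<exists>R\<ge>T. \<not> sphere 0 (2 * R) \<subseteq> f ` cball 0 R \<and> \<not> sphere 0 (4 * R) \<subseteq> f ` cball 0 R" for T
      by blast
    define C where "C = exp (pi * exp (pi * (2 + 2 * (3/2) + 12)))"
    have "\<exists>R\<ge>T. \<forall>z. norm z \<le> R / 2 \<longrightarrow> norm (f z) \<le> (6 * C + 2) * R" for T
    proof -
      obtain R w1 w2 where R: "R \<ge> max T (max 1 (norm (f 0)))"
        and w1: "w1 \<in> sphere 0 (2 * R)" "w1 \<notin> f ` cball 0 R"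
        and w2: "w2 \<in> sphere 0 (4 * R)" "w2 \<notin> f ` cball 0 R"
        using bad[of "max T (max 1 (norm (f 0)))"] by blast
      have R1: "R \<ge> 1" "norm (f 0) \<le> R" using R by auto
      have nw: "norm w1 = 2 * R" "norm w2 = 4 * R" using w1 w2 by auto
      have d: "norm (w2 - w1) \<ge> 2 * R" "norm (w2 - w1) \<le> 6 * R"
        using norm_triangle_ineq2[of w2 w1] norm_triangle_ineq4[of w2 w1] nw by auto
      have "norm (f 0 - w1) \<le> 3 * R"
        using norm_triangle_ineq4[of "f 0" w1] nw R1 by simp
      then have f0: "norm (f 0 - w1) \<le> 3/2 * norm (w2 - w1)" using d by simp
      have "norm (f z) \<le> (6 * C + 2) * R" if "norm z \<le> R / 2" for z
      proof -
        have "norm (f z - w1) \<le> C * norm (w2 - w1)"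
          unfolding C_def
        proof (rule Schottky_two_values[of f 0 R])
          show "f holomorphic_on cball 0 R"
            using f unfolding entire_def using holomorphic_on_subset by blast
        qed (use that f0 R1 nw w1 w2 in auto)
        also have "\<dots> \<le> C * (6 * R)"
          using d(2) by (intro mult_left_mono) (auto simp: C_def)
        finally have "norm (f z) \<le> C * (6 * R) + 2 * R"
          using norm_triangle_ineq2[of "f z" w1] nw by linarith
        then show ?thesis by (simp add: algebra_simps)
      qed
      then show ?thesis using R by (intro exI[of _ R]) auto
    qed
    then have "\<forall>z. f z = poly [:f 0, deriv f 0:] z"
      using linear_if_linear_growth_along_radii[OF f] by blast
    then show False using assms unfolding transcendental_entire_def by blast
  qed
  then obtain T where "\<forall>R\<ge>T. sphere 0 (2 * R) \<subseteq> f ` cball 0 R \<or> sphere 0 (4 * R) \<subseteq> f ` cball 0 R"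
    by blast
  then show ?thesis by (intro that[of "max 1 T"]) auto
qed

lemma max_modulus_cball:
  assumes "entire h" "\<And>z. z \<in> sphere 0 r \<Longrightarrow> norm (h z) \<le> B" "z \<in> cball 0 r"
  shows "norm (h z) \<le> B"
proof (rule maximum_modulus_frontier[of h "cball 0 r"])
  show "h holomorphic_on interior (cball 0 r)"
    using assms(1) unfolding entire_def using holomorphic_on_subset by blast
qed (use assms in \<open>auto intro: entire_imp_continuous_on\<close>)

text \<open>
  Suppose all iterates are bounded by \<open>S\<close> on \<open>cball 0 r\<close>.  If the image of this disc contains a
  circle of radius at least \<open>2 * r\<close>, then the iterates are bounded by the same \<open>S\<close> on that circle and,
  by the maximum principle, inside it.  Iterating, \<open>S\<close> bounds the identity on arbitrarily large discs.
\<close>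

lemma bounded_orbit_set_ne_UNIV:
  assumes "transcendental_entire f"
  shows "bounded_orbit_set f \<noteq> UNIV"
proof
  assume U: "bounded_orbit_set f = UNIV"
  have f: "entire f" using assms by (simp add: transcendental_entire_def)
  obtain R0 where R0: "R0 \<ge> 1"
    "\<And>R. R \<ge> R0 \<Longrightarrow> sphere 0 (2 * R) \<subseteq> f ` cball 0 R \<or> sphere 0 (4 * R) \<subseteq> f ` cball 0 R"
    by (rule transcendental_image_contains_circle[OF assms]) blast
  obtain S where S: "\<And>n w. w \<in> cball 0 R0 \<Longrightarrow> norm ((f ^^ n) w) \<le> S"
    using bounded_orbit_set_compact[OF compact_cball, of 0 R0 f] U by auto
  have "\<exists>r\<ge>2 ^ j * R0. \<forall>n. \<forall>w\<in>cball 0 r. norm ((f ^^ n) w) \<le> S" for j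
  proof (induction j)
    case 0
    then show ?case using S by (intro exI[of _ R0]) auto
  next
    case (Suc j)
    then obtain r where r: "r \<ge> 2 ^ j * R0" and rS: "\<And>n w. w \<in> cball 0 r \<Longrightarrow> norm ((f ^^ n) w) \<le> S"
      by blast
    have "1 * R0 \<le> 2 ^ j * R0" using R0(1) by (intro mult_right_mono) auto
    then have "r \<ge> R0" using r by simp
    moreover have "4 * r \<ge> 2 * r" using \<open>r \<ge> R0\<close> R0(1) by simp
    ultimately obtain r' where r': "r' \<ge> 2 * r" "sphere 0 r' \<subseteq> f ` cball 0 r"
      using R0(2)[of r] by blast
    have "norm ((f ^^ n) w) \<le> S" if "w \<in> cball 0 r'" for n w
    proof (rule max_modulus_cball[OF entire_funpow[OF f] _ that])
      fix v :: complex assume "v \<in> sphere 0 r'"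
      then obtain u where "u \<in> cball 0 r" "v = f u" using r'(2) by blast
      then show "norm ((f ^^ n) v) \<le> S"
        using rS[of u "Suc n"] by (simp add: funpow_swap1)
    qed
    moreover have "r' \<ge> 2 ^ Suc j * R0" using r'(1) r by simp
    ultimately show ?case by blast
  qed
  moreover obtain j where j: "2 ^ j > S" using real_arch_pow[of 2 S] by auto
  ultimately obtain r where r: "r \<ge> 2 ^ j * R0" "\<And>n w. w \<in> cball 0 r \<Longrightarrow> norm ((f ^^ n) w) \<le> S"
    by blast
  have "(2::real) ^ j \<le> 2 ^ j * R0" using mult_left_mono[OF R0(1), of "2 ^ j"] by simp
  moreover have "(0::real) \<le> 2 ^ j" by simp
  ultimately have "r > S" "r \<ge> 0" using r(1) j by linarith+
  \<comment> \<open>the identity is the iterate number \<open>0\<close>\<close>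
  with r(2)[of "of_real r" 0] show False by simp
qed

section \<open>Components are conformal discs\<close>

text \<open>
  By the maximum principle, bounds for the iterates on a closed curve extend to its inside.  So the
  inside of a curve in a component belongs to \<open>B\<close>, and hence to the same component.
\<close>

lemma bounded_orbit_component_simply_connected:
  assumes f: "entire f"
  defines "B \<equiv> bounded_orbit_set f"
  shows "simply_connected (connected_component_set B a)"
proof -
  define W where "W = connected_component_set B a"
  have oB: "open B" unfolding B_def by (rule open_bounded_orbit_set)
  have oW: "open W" unfolding W_def by (rule open_connected_component[OF oB])
  have WB: "W \<subseteq> B" unfolding W_def by (rule connected_component_subset)
  have "winding_number g z = 0"
    if g: "path g" "path_image g \<subseteq> W" "pathfinish g = pathstart g" and z: "z \<notin> W" for g z
  proof -
    define L where "L = path_image g"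
    have L: "compact L" "connected L" "L \<noteq> {}" "L \<subseteq> W"
      unfolding L_def using g by (auto simp: compact_path_image connected_path_image)
    obtain M where M: "\<And>n w. w \<in> L \<Longrightarrow> norm ((f ^^ n) w) \<le> M"
      using bounded_orbit_set_compact[of L f] L WB unfolding B_def by blast
    have bi: "bounded (inside L)" using L(1) by (simp add: bounded_inside compact_imp_bounded)
    have oi: "open (inside L)" using L(1) by (simp add: open_inside compact_imp_closed)
    have "norm ((f ^^ n) w) \<le> M" if "w \<in> inside L" for n w
    proof (rule maximum_modulus_frontier[OF _ _ bi _ that])
      show "(f ^^ n) holomorphic_on interior (inside L)"
        using entire_funpow[OF f] unfolding entire_def using holomorphic_on_subset by blast
      show "continuous_on (closure (inside L)) (f ^^ n)"
        by (rule entire_imp_continuous_on[OF entire_funpow[OF f]])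
      show "norm ((f ^^ n) v) \<le> M" if "v \<in> frontier (inside L)" for v
        using frontier_inside_subset[OF compact_imp_closed[OF L(1)]] that M by blast
    qed
    then have "inside L \<subseteq> B"
      unfolding B_def using bounded_orbit_setI[OF oi] by blast
    then have sub: "L \<union> inside L \<subseteq> B" using L WB by blast
    have con: "connected (L \<union> inside L)"
      using connected_with_inside[OF compact_imp_closed[OF L(1)] L(2)] .
    obtain p where p: "p \<in> L" using L(3) by blast
    have "L \<union> inside L \<subseteq> connected_component_set B p"
      by (rule connected_component_maximal[OF _ con sub]) (use p in simp)
    also have "connected_component_set B p = W"
      using p L(4) unfolding W_def by (metis connected_component_eq subsetD)
    finally have "z \<notin> L \<union> inside L" using z by blast
    then have "z \<in> outside L" using inside_Un_outside[of L] by blast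
    then show ?thesis
      unfolding L_def by (rule winding_number_zero_in_outside[OF g(1,3)])
  qed
  moreover have "connected W" unfolding W_def by (rule connected_connected_component)
  ultimately show ?thesis
    using simply_connected_eq_winding_number_zero[OF oW] unfolding W_def by blast
qed

text \<open>
  The map \<open>\<theta>\<close> is a Riemann map of \<open>W\<close> that vanishes at \<open>a\<close>, and \<open>\<psi>\<close> is its inverse.
\<close>

definition conformal_disc_at ::
  "complex set \<Rightarrow> complex \<Rightarrow> (complex \<Rightarrow> complex) \<Rightarrow> (complex \<Rightarrow> complex) \<Rightarrow> bool" where
  "conformal_disc_at W a \<theta> \<psi> \<longleftrightarrow>
     \<theta> holomorphic_on W \<and> \<psi> holomorphic_on ball 0 1 \<and>
     (\<forall>z\<in>W. \<theta> z \<in> ball 0 1 \<and> \<psi> (\<theta> z) = z) \<and> (\<forall>u\<in>ball 0 1. \<psi> u \<in> W \<and> \<theta> (\<psi> u) = u) \<and>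
     \<theta> a = 0 \<and> \<psi> 0 = a"

lemma bounded_orbit_component_conformal_disc:
  assumes f: "transcendental_entire f" and a: "a \<in> bounded_orbit_set f"
  obtains \<theta> \<psi> where "conformal_disc_at (connected_component_set (bounded_orbit_set f) a) a \<theta> \<psi>"
proof -
  define W where "W = connected_component_set (bounded_orbit_set f) a"
  have "entire f" using f by (simp add: transcendental_entire_def)
  then have "simply_connected W"
    unfolding W_def by (rule bounded_orbit_component_simply_connected)
  moreover have "open W"
    unfolding W_def by (rule open_connected_component[OF open_bounded_orbit_set])
  moreover have aW: "a \<in> W" using a by (simp add: W_def)
  moreover have "W \<noteq> UNIV"
    using bounded_orbit_set_ne_UNIV[OF f] connected_component_subset unfolding W_def by blast
  ultimately obtain p q where pq: "p holomorphic_on W" "q holomorphic_on ball 0 1"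
    "\<forall>z\<in>W. p z \<in> ball 0 1 \<and> q (p z) = z" "\<forall>z\<in>ball 0 1. q z \<in> W \<and> p (q z) = z"
    using Riemann_mapping_theorem[of W] by blast
  have "p a \<in> ball 0 1" using pq aW by blast
  then obtain s t where st: "s (p a) = 0" "s holomorphic_on ball 0 1" "s ` ball 0 1 \<subseteq> ball 0 1"
    "t holomorphic_on ball 0 1" "t ` ball 0 1 \<subseteq> ball 0 1"
    "\<And>z. z \<in> ball 0 1 \<Longrightarrow> s (t z) = z" "\<And>z. z \<in> ball 0 1 \<Longrightarrow> t (s z) = z"
    using ball_biholomorphism_exists by metis
  have t0: "t 0 = p a" using st(1,7) \<open>p a \<in> ball 0 1\<close> by metis
  have "conformal_disc_at W a (s \<circ> p) (q \<circ> t)"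
    unfolding conformal_disc_at_def
  proof (intro conjI ballI)
    show "s \<circ> p holomorphic_on W"
      using pq st by (intro holomorphic_on_compose_gen[of p W s "ball 0 1"]) auto
    show "q \<circ> t holomorphic_on ball 0 1"
      using pq st by (intro holomorphic_on_compose_gen[of t _ q "ball 0 1"]) auto
    show "(s \<circ> p) z \<in> ball 0 1" "(q \<circ> t) ((s \<circ> p) z) = z" if "z \<in> W" for z
      using that pq(3) st(3,7) by fastforce+
    show "(q \<circ> t) u \<in> W" "(s \<circ> p) ((q \<circ> t) u) = u" if "u \<in> ball 0 1" for u
      using that pq(4) st(5,6) by fastforce+
    show "(s \<circ> p) a = 0" using st(1) by simp
    show "(q \<circ> t) 0 = a" using t0 pq(3) aW by simp
  qed
  then show ?thesis using that unfolding W_def by blast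
qed

section \<open>Self-maps of the disc with a relatively compact orbit\<close>

lemma pseudohyperbolic_identity:
  fixes x z :: complex
  shows "(1 - (norm z)\<^sup>2) * (1 - (norm x)\<^sup>2) = (norm (1 - cnj x * z))\<^sup>2 - (norm (z - x))\<^sup>2"
  unfolding cmod_power2 by (simp add: power2_eq_square algebra_simps)

text \<open>
  The set is a pseudohyperbolic disc, and therefore a Euclidean disc: its defining inequality
  is quadratic in \<open>z\<close> with the positive multiple \<open>A\<close> of \<open>norm z ^ 2\<close> as leading part, and completing
  the square gives the centre \<open>s * x\<close> and the squared radius \<open>c\<close>.
\<close>

lemma pseudohyperbolic_disc_convex:
  fixes x :: complex
  assumes x: "norm x < 1" and \<rho>: "0 \<le> \<rho>" "\<rho> < 1"
  shows "convex {z. norm (z - x) \<le> \<rho> * norm (1 - cnj x * z)}"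
proof -
  define A where "A = 1 - \<rho>\<^sup>2 * (norm x)\<^sup>2"
  have "\<rho>\<^sup>2 * (norm x)\<^sup>2 < 1"
  proof -
    have "\<rho> * norm x < 1 * 1" using x \<rho> by (intro mult_strict_mono') auto
    then have "(\<rho> * norm x)\<^sup>2 < 1\<^sup>2" using \<rho>(1) by (intro power_strict_mono) auto
    then show ?thesis by (simp add: power_mult_distrib)
  qed
  then have A: "A > 0" by (simp add: A_def)
  define s where "s = (1 - \<rho>\<^sup>2) / A"
  have As: "A * s = 1 - \<rho>\<^sup>2" using A by (simp add: s_def)
  define c where "c = s\<^sup>2 * (norm x)\<^sup>2 - ((norm x)\<^sup>2 - \<rho>\<^sup>2) / A"
  have Ac: "A * c = (A * s) * s * (norm x)\<^sup>2 - ((norm x)\<^sup>2 - \<rho>\<^sup>2)"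
  proof -
    have "A * (((norm x)\<^sup>2 - \<rho>\<^sup>2) / A) = (norm x)\<^sup>2 - \<rho>\<^sup>2" using A by simp
    then show ?thesis unfolding c_def by (simp only: right_diff_distrib power2_eq_square mult.assoc)
  qed
  have key: "(norm (z - x))\<^sup>2 - \<rho>\<^sup>2 * (norm (1 - cnj x * z))\<^sup>2 = A * ((norm (z - of_real s * x))\<^sup>2 - c)" for z
  proof -
    define I where "I = Re (cnj x * z)"
    have 1: "(norm (z - x))\<^sup>2 = (norm z)\<^sup>2 - 2 * I + (norm x)\<^sup>2"
      unfolding I_def cmod_power2 by (simp add: power2_eq_square algebra_simps)
    have 2: "(norm (1 - cnj x * z))\<^sup>2 = 1 - 2 * I + (norm x)\<^sup>2 * (norm z)\<^sup>2"
      unfolding I_def cmod_power2 by (simp add: power2_eq_square algebra_simps)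
    have 3: "(norm (z - of_real s * x))\<^sup>2 = (norm z)\<^sup>2 - 2 * s * I + s\<^sup>2 * (norm x)\<^sup>2"
      unfolding I_def cmod_power2 by (simp add: power2_eq_square algebra_simps)
    have "A * ((norm (z - of_real s * x))\<^sup>2 - c) =
        A * (norm z)\<^sup>2 - 2 * (A * s) * I + (A * s) * s * (norm x)\<^sup>2 - A * c"
      unfolding 3 by (simp add: power2_eq_square algebra_simps)
    also have "\<dots> = A * (norm z)\<^sup>2 - 2 * (1 - \<rho>\<^sup>2) * I + ((norm x)\<^sup>2 - \<rho>\<^sup>2)"
      unfolding Ac As by simp
    also have "\<dots> = (norm (z - x))\<^sup>2 - \<rho>\<^sup>2 * (norm (1 - cnj x * z))\<^sup>2"
      unfolding 1 2 A_def by (simp add: algebra_simps)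
    finally show ?thesis by simp
  qed
  have eq: "norm (z - x) \<le> \<rho> * norm (1 - cnj x * z) \<longleftrightarrow> (norm (z - of_real s * x))\<^sup>2 \<le> c" for z
  proof -
    have "norm (z - x) \<le> \<rho> * norm (1 - cnj x * z) \<longleftrightarrow> (norm (z - x))\<^sup>2 \<le> (\<rho> * norm (1 - cnj x * z))\<^sup>2"
      using \<rho>(1) by (intro power_mono_iff[symmetric]) auto
    also have "\<dots> \<longleftrightarrow> A * ((norm (z - of_real s * x))\<^sup>2 - c) \<le> 0"
      unfolding key[symmetric] by (simp add: power_mult_distrib)
    also have "\<dots> \<longleftrightarrow> (norm (z - of_real s * x))\<^sup>2 \<le> c"
      using A by (simp add: mult_le_0_iff)
    finally show ?thesis .
  qed
  have "c \<ge> 0" using eq[of x] \<rho>(1) order_trans[OF zero_le_power2] by fastforce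
  then have "{z. norm (z - x) \<le> \<rho> * norm (1 - cnj x * z)} = cball (of_real s * x) (sqrt c)"
    unfolding eq
    by (auto simp: dist_norm norm_minus_commute real_le_rsqrt dest: real_sqrt_le_mono intro: sqrt_ge_absD)
  then show ?thesis by simp
qed

lemma one_minus_cnj_mult_nonzero:
  assumes "norm x < 1" "norm z < 1"
  shows "1 - cnj x * z \<noteq> 0"
proof
  assume "1 - cnj x * z = 0"
  then have "norm x * norm z = 1"
    by (metis complex_mod_cnj eq_iff_diff_eq_0 norm_mult norm_one)
  moreover have "norm x * norm z < 1 * 1" using assms by (intro mult_strict_mono') auto
  ultimately show False by simp
qed

text \<open>
  Schwarz's lemma for \<open>F\<close>, after Moebius transformations that move \<open>x\<close> and \<open>F x\<close> to \<open>0\<close>.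
\<close>

lemma Schwarz_Pick:
  assumes F: "F holomorphic_on ball 0 1" "F ` ball 0 1 \<subseteq> ball 0 1"
    and x: "norm x < 1" and z: "norm z < 1"
    and d: "norm (z - x) \<le> \<rho> * norm (1 - cnj x * z)"
  shows "norm (F z - F x) \<le> \<rho> * norm (1 - cnj (F x) * F z)"
proof -
  have Fn: "norm (F u) < 1" if "norm u < 1" for u
    using F(2) that by (auto simp: image_subset_iff)
  define G where "G = Moebius_function 0 (F x) \<circ> (F \<circ> Moebius_function 0 (- x))"
  have hol: "G holomorphic_on ball 0 1"
    unfolding G_def
  proof (intro holomorphic_on_compose_gen[where t = "ball 0 1"])
    show "Moebius_function 0 (- x) holomorphic_on ball 0 1"
      using x by (intro Moebius_function_holomorphic) simp
    show "Moebius_function 0 (F x) holomorphic_on ball 0 1"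
      using Fn[OF x] by (rule Moebius_function_holomorphic)
    show "Moebius_function 0 (- x) ` ball 0 1 \<subseteq> ball 0 1"
      using x by (auto intro!: Moebius_function_norm_lt_1)
    then show "(F \<circ> Moebius_function 0 (- x)) ` ball 0 1 \<subseteq> ball 0 1"
      using F(2) by (auto simp: image_subset_iff)
  qed (rule F)
  have G0: "G 0 = 0"
    by (simp add: G_def Moebius_function_of_zero Moebius_function_eq_zero)
  have Gn: "norm (G u) < 1" if "norm u < 1" for u
    unfolding G_def o_def using x that by (intro Moebius_function_norm_lt_1 Fn) auto
  define u where "u = Moebius_function 0 x z"
  have u: "norm u < 1" unfolding u_def by (rule Moebius_function_norm_lt_1[OF x z])
  have "G u = Moebius_function 0 (F x) (F z)"
    unfolding G_def u_def using Moebius_function_compose[of "- x" x z] x z by simp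
  then have "norm (Moebius_function 0 (F x) (F z)) \<le> norm (Moebius_function 0 x z)"
    using Schwarz_Lemma(1)[OF hol G0 Gn u] by (simp add: u_def)
  also have "\<dots> \<le> \<rho>"
    using d one_minus_cnj_mult_nonzero[OF x z]
    by (simp add: Moebius_function_simple norm_divide divide_simps)
  finally show ?thesis
    using one_minus_cnj_mult_nonzero[OF Fn[OF x] Fn[OF z]]
    by (simp add: Moebius_function_simple norm_divide divide_simps split: if_splits)
qed

text \<open>
  Let \<open>x n\<close> be the orbit.  By the Schwarz-Pick lemma \<open>F\<close> maps the set \<open>C N\<close> of points
  within pseudohyperbolic distance \<open>\<rho>\<close> of every \<open>x n\<close> with \<open>n \<ge> N\<close> into \<open>C (Suc N)\<close>.  These sets are convex
  and increase with \<open>N\<close>, so the closure of their union is a convex set invariant under \<open>F\<close>.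
  Since the orbit is relatively compact, a suitable \<open>\<rho> < 1\<close> makes \<open>C 0\<close> nonempty, and the
  closure is a compact subset of the open disc.  Brouwer's theorem applies.
\<close>

lemma disc_self_map_fixed_point:
  assumes F: "F holomorphic_on ball 0 1" "F ` ball 0 1 \<subseteq> ball 0 1"
    and K: "compact K" "K \<subseteq> ball 0 1" and orbit: "\<And>n. (F ^^ n) x0 \<in> K"
  obtains x where "x \<in> ball 0 1" "F x = x"
proof -
  define x where "x n = (F ^^ n) x0" for n
  obtain s where s: "0 \<le> s" "s < 1" "\<And>n. norm (x n) \<le> s"
  proof -
    have "K \<noteq> {}" using orbit by blast
    then obtain v where v: "v \<in> K" "\<And>u. u \<in> K \<Longrightarrow> norm u \<le> norm v"
      using continuous_attains_sup[OF K(1), of norm] continuous_on_norm_id by blast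
    then show ?thesis using that[of "norm v"] K(2) orbit by (auto simp: x_def)
  qed
  have xn: "norm (x n) < 1" for n using s(2) s(3)[of n] by simp
  \<comment> \<open>Points \<open>y\<close>, \<open>z\<close> of modulus at most \<open>s\<close> have squared pseudohyperbolic distance
    \<open>1 - (1 - norm y ^ 2) * (1 - norm z ^ 2) / norm (1 - cnj y * z) ^ 2 \<le> 1 - m\<close>, as the
    denominator is at most \<open>4\<close>.\<close>
  define m where "m = (1 - s\<^sup>2)\<^sup>2 / 4"
  have s2: "0 \<le> s\<^sup>2" "s\<^sup>2 < 1" using s by (auto simp: power_less_one_iff abs_square_less_1)
  have m: "0 < m" "m \<le> 1/4"
    using s2 unfolding m_def by (auto simp: power_le_one)
  define \<rho> where "\<rho> = sqrt (1 - m)"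
  have \<rho>: "0 \<le> \<rho>" "\<rho> < 1" "\<rho>\<^sup>2 = 1 - m" using m by (auto simp: \<rho>_def)
  define C where "C N = ball 0 1 \<inter> (\<Inter>n\<in>{N..}. {z. norm (z - x n) \<le> \<rho> * norm (1 - cnj (x n) * z)})" for N
  have start: "x 0 \<in> C 0"
    unfolding C_def
  proof (intro IntI INT_I CollectI)
    show "x 0 \<in> ball 0 1" using xn by simp
    fix n
    have sq: "(norm (x k))\<^sup>2 \<le> s\<^sup>2" for k
      using s(3)[of k] by (intro power_mono) auto
    have "(1 - s\<^sup>2) * (1 - s\<^sup>2) \<le> (1 - (norm (x 0))\<^sup>2) * (1 - (norm (x n))\<^sup>2)"
      by (intro mult_mono) (use sq[of 0] sq[of n] s2 in linarith)+
    then have 1: "(norm (x 0 - x n))\<^sup>2 \<le> (norm (1 - cnj (x n) * x 0))\<^sup>2 - 4 * m"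
      unfolding pseudohyperbolic_identity by (simp add: m_def power2_eq_square)
    have "norm (1 - cnj (x n) * x 0) \<le> 1 + norm (x n) * norm (x 0)"
      using norm_triangle_ineq4[of 1 "cnj (x n) * x 0"] by (simp add: norm_mult)
    also have "\<dots> \<le> 1 + 1 * 1"
      using xn less_imp_le by (intro add_left_mono mult_mono) auto
    finally have "(norm (1 - cnj (x n) * x 0))\<^sup>2 \<le> 2\<^sup>2"
      by (intro power_mono) auto
    then have "m * (norm (1 - cnj (x n) * x 0))\<^sup>2 \<le> m * 4"
      using m by (intro mult_left_mono) auto
    then have "(norm (x 0 - x n))\<^sup>2 \<le> (\<rho> * norm (1 - cnj (x n) * x 0))\<^sup>2"
      using 1 by (simp add: power_mult_distrib \<rho>(3) algebra_simps)
    then show "norm (x 0 - x n) \<le> \<rho> * norm (1 - cnj (x n) * x 0)"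
      using \<rho>(1) by (intro power2_le_imp_le[of "norm (x 0 - x n)"]) auto
  qed
  \<comment> \<open>a point within distance \<open>\<rho>\<close> of a point of modulus at most \<open>s\<close> has modulus at most \<open>\<tau>\<close>\<close>
  define \<tau> where "\<tau> = sqrt (1 - m * (1 - s)\<^sup>2)"
  have ms: "0 < m * (1 - s)\<^sup>2" using m s by simp
  have "\<tau> < 1" using ms by (simp add: \<tau>_def)
  have CT: "C N \<subseteq> cball 0 \<tau>" for N
  proof
    fix z assume z: "z \<in> C N"
    then have z1: "norm z < 1" and zd: "norm (z - x N) \<le> \<rho> * norm (1 - cnj (x N) * z)"
      unfolding C_def by auto
    define t where "t = (norm (1 - cnj (x N) * z))\<^sup>2"
    have "(norm (z - x N))\<^sup>2 \<le> (\<rho> * norm (1 - cnj (x N) * z))\<^sup>2"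
      using zd by (intro power_mono) auto
    then have "(norm (z - x N))\<^sup>2 \<le> (1 - m) * t"
      by (simp add: power_mult_distrib \<rho>(3) t_def)
    then have "m * t \<le> (1 - (norm z)\<^sup>2) * (1 - (norm (x N))\<^sup>2)"
      unfolding pseudohyperbolic_identity t_def[symmetric] by (simp add: algebra_simps)
    also have "\<dots> \<le> (1 - (norm z)\<^sup>2) * 1"
      using z1 by (intro mult_left_mono) (auto simp: power_le_one)
    finally have a: "m * t \<le> 1 - (norm z)\<^sup>2" by simp
    have "norm (cnj (x N) * z) \<le> s * 1"
      unfolding norm_mult complex_mod_cnj using s z1 by (intro mult_mono) auto
    then have "1 - s \<le> norm (1 - cnj (x N) * z)"
      using norm_triangle_ineq2[of 1 "cnj (x N) * z"] by simp
    then have "(1 - s)\<^sup>2 \<le> t" unfolding t_def using s by (intro power_mono) auto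
    then have "m * (1 - s)\<^sup>2 \<le> m * t" using m by (intro mult_left_mono) auto
    then have "(norm z)\<^sup>2 \<le> 1 - m * (1 - s)\<^sup>2" using a by simp
    then show "z \<in> cball 0 \<tau>" by (simp add: \<tau>_def real_le_rsqrt)
  qed
  have mono: "C N \<subseteq> C M" if "N \<le> M" for N M
    using that unfolding C_def by (intro Int_mono INT_anti_mono) auto
  have conv: "convex (C N)" for N
    unfolding C_def
    by (intro convex_Int convex_ball convex_INT pseudohyperbolic_disc_convex xn \<rho>)
  have "convex (\<Union>N. C N)"
    unfolding convex_def
  proof (intro ballI allI impI)
    fix y z and u v :: real
    assume "y \<in> (\<Union>N. C N)" "z \<in> (\<Union>N. C N)" and uv: "0 \<le> u" "0 \<le> v" "u + v = 1"
    then obtain N M where "y \<in> C N" "z \<in> C M" by blast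
    then have "y \<in> C (max N M)" "z \<in> C (max N M)" using mono[of N "max N M"] mono[of M "max N M"] by auto
    then have "u *\<^sub>R y + v *\<^sub>R z \<in> C (max N M)" using conv uv unfolding convex_def by blast
    then show "u *\<^sub>R y + v *\<^sub>R z \<in> (\<Union>N. C N)" by blast
  qed
  define E where "E = closure (\<Union>N. C N)"
  have E1: "convex E" unfolding E_def using \<open>convex (\<Union>N. C N)\<close> by (rule convex_closure)
  have ET: "E \<subseteq> cball 0 \<tau>" unfolding E_def using CT by (intro closure_minimal) auto
  then have E2: "compact E" 
    unfolding E_def by (meson bounded_cball bounded_subset closed_closure compact_eq_bounded_closed)
  have "(\<Union>N. C N) \<subseteq> E" unfolding E_def by (rule closure_subset)
  then have E3: "E \<noteq> {}" using start by blast
  have Eb: "E \<subseteq> ball 0 1" using ET \<open>\<tau> < 1\<close> by auto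
  have contF: "continuous_on E F"
    using F(1) Eb by (meson continuous_on_subset holomorphic_on_imp_continuous_on)
  have "F ` (\<Union>N. C N) \<subseteq> (\<Union>N. C N)"
  proof
    fix y assume "y \<in> F ` (\<Union>N. C N)"
    then obtain N z where z: "z \<in> C N" "y = F z" by blast
    have "y \<in> C (Suc N)"
      unfolding C_def
    proof (intro IntI INT_I CollectI)
      show "y \<in> ball 0 1" using z F(2) by (auto simp: C_def image_subset_iff)
      fix n assume "n \<in> {Suc N..}"
      then obtain k where k: "n = Suc k" "k \<ge> N" by (cases n) auto
      have "norm (z - x k) \<le> \<rho> * norm (1 - cnj (x k) * z)" "norm z < 1"
        using z(1) k(2) by (auto simp: C_def)
      then have "norm (F z - F (x k)) \<le> \<rho> * norm (1 - cnj (F (x k)) * F z)"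
        by (intro Schwarz_Pick[OF F xn])
      then show "norm (y - x n) \<le> \<rho> * norm (1 - cnj (x n) * y)"
        by (simp add: z(2) k(1) x_def)
    qed
    then show "y \<in> (\<Union>N. C N)" by blast
  qed
  from this closure_subset have "F ` (\<Union>N. C N) \<subseteq> closure (\<Union>N. C N)" by (rule order_trans)
  then have "F ` E \<subseteq> E"
    unfolding E_def by (rule image_closure_subset[OF contF[unfolded E_def] closed_closure])
  then obtain y where "y \<in> E" "F y = y"
    using brouwer[OF E2 E1 E3 contF] by blast
  then show ?thesis using that Eb by blast
qed

section \<open>Schwarz's lemma on the components\<close>

abbreviation orbit_component :: "(complex \<Rightarrow> complex) \<Rightarrow> complex \<Rightarrow> complex set" where
  "orbit_component f z \<equiv> connected_component_set (bounded_orbit_set f) z"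

lemma orbit_component_basics:
  "open (orbit_component f a)" "connected (orbit_component f a)"
  "orbit_component f a \<subseteq> bounded_orbit_set f"
  "z \<in> orbit_component f a \<Longrightarrow> orbit_component f z = orbit_component f a"
  "a \<in> bounded_orbit_set f \<Longrightarrow> a \<in> orbit_component f a"
proof -
  show "z \<in> orbit_component f a \<Longrightarrow> orbit_component f z = orbit_component f a"
    using connected_component_eq[of z "bounded_orbit_set f" a] by simp
qed (auto simp: open_connected_component[OF open_bounded_orbit_set] dest: connected_component_in)

lemma connected_subset_orbit_component:
  assumes "connected A" "A \<subseteq> bounded_orbit_set f" "p \<in> A" "p \<in> orbit_component f a"
  shows "A \<subseteq> orbit_component f a"
  using connected_component_maximal[OF assms(3,1,2)] orbit_component_basics(4)[OF assms(4)] by simp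

lemma image_orbit_component:
  assumes k: "entire k" "\<And>z. z \<in> bounded_orbit_set f \<Longrightarrow> k z \<in> bounded_orbit_set f"
    and z: "z \<in> orbit_component f a"
  shows "k z \<in> orbit_component f (k a)"
proof -
  have a: "a \<in> bounded_orbit_set f" using z connected_component_eq_empty by blast
  have "k ` orbit_component f a \<subseteq> orbit_component f (k a)"
  proof (rule connected_subset_orbit_component[where p = "k a"])
    show "connected (k ` orbit_component f a)"
      by (intro connected_continuous_image entire_imp_continuous_on k(1) orbit_component_basics)
    show "k ` orbit_component f a \<subseteq> bounded_orbit_set f"
      using k(2) orbit_component_basics(3) by blast
    show "k a \<in> k ` orbit_component f a" using orbit_component_basics(5)[OF a] by blast
    show "k a \<in> orbit_component f (k a)" by (rule orbit_component_basics(5)[OF k(2)[OF a]])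
  qed
  then show ?thesis using z by blast
qed

lemma conformal_disc_conjugate:
  assumes D: "conformal_disc_at W a \<theta> \<psi>" "conformal_disc_at W' a' \<theta>' \<psi>'"
    and k: "entire k" "\<And>z. z \<in> W \<Longrightarrow> k z \<in> W'"
  shows "(\<theta>' \<circ> (k \<circ> \<psi>)) holomorphic_on ball 0 1" "(\<theta>' \<circ> (k \<circ> \<psi>)) ` ball 0 1 \<subseteq> ball 0 1"
proof -
  have "(k \<circ> \<psi>) holomorphic_on ball 0 1"
    using D(1) k(1) unfolding conformal_disc_at_def entire_def
    by (intro holomorphic_on_compose_gen[of _ _ k UNIV]) auto
  moreover have "(k \<circ> \<psi>) ` ball 0 1 \<subseteq> W'"
    using D(1) k(2) unfolding conformal_disc_at_def by auto
  ultimately show "(\<theta>' \<circ> (k \<circ> \<psi>)) holomorphic_on ball 0 1"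
    using D(2) unfolding conformal_disc_at_def by (intro holomorphic_on_compose_gen[of _ _ \<theta>' W']) auto
  show "(\<theta>' \<circ> (k \<circ> \<psi>)) ` ball 0 1 \<subseteq> ball 0 1"
    using \<open>(k \<circ> \<psi>) ` ball 0 1 \<subseteq> W'\<close> D(2) unfolding conformal_disc_at_def
    by (simp add: image_subset_iff)
qed

lemma conformal_disc_Schwarz:
  assumes D: "conformal_disc_at W a \<theta> \<psi>" "conformal_disc_at W' a' \<theta>' \<psi>'"
    and k: "entire k" "\<And>z. z \<in> W \<Longrightarrow> k z \<in> W'" "k a = a'" and z: "z \<in> W"
  shows "norm (\<theta>' (k z)) \<le> norm (\<theta> z)"
proof -
  have "norm ((\<theta>' \<circ> (k \<circ> \<psi>)) (\<theta> z)) \<le> norm (\<theta> z)"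
  proof (rule Schwarz_Lemma(1)[OF conformal_disc_conjugate(1)[OF D k(1,2)]])
    show "(\<theta>' \<circ> (k \<circ> \<psi>)) 0 = 0" using D k(3) by (simp add: conformal_disc_at_def)
    show "norm ((\<theta>' \<circ> (k \<circ> \<psi>)) u) < 1" if "norm u < 1" for u
      using conformal_disc_conjugate(2)[OF D k(1,2)] that by (auto simp: image_subset_iff)
    show "norm (\<theta> z) < 1" using D(1) z by (simp add: conformal_disc_at_def)
  qed
  then show ?thesis using D(1) z by (simp add: conformal_disc_at_def)
qed

text \<open>
  The iterates between two consecutive multiples of \<open>N\<close> are obtained by applying the finitely many maps
  \<open>f ^^ i\<close>, \<open>i < N\<close>, to points of a fixed disc.
\<close>

lemma bounded_subsequence_imp_bounded_orbit_set:
  assumes f: "entire f" and U: "open U" "z \<in> U" and N: "N > 0"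
    and M: "\<And>k w. w \<in> U \<Longrightarrow> norm ((f ^^ (N * k)) w) \<le> M"
  shows "z \<in> bounded_orbit_set f"
proof -
  have "\<exists>C. \<forall>w\<in>cball 0 M. norm ((f ^^ i) w) \<le> C" for i
    using entire_bounded_on_compact[OF entire_funpow[OF f] compact_cball] by metis
  then obtain C where C: "\<And>i w. w \<in> cball 0 M \<Longrightarrow> norm ((f ^^ i) w) \<le> C i"
    by metis
  show ?thesis
  proof (rule bounded_orbit_setI[OF U])
    fix n w assume w: "w \<in> U"
    have "(f ^^ n) w = (f ^^ (n mod N)) ((f ^^ (N * (n div N))) w)"
      by (metis comp_apply funpow_add mod_mult_div_eq)
    then have "norm ((f ^^ n) w) \<le> C (n mod N)"
      using C M[OF w] by simp
    also have "\<dots> \<le> (\<Sum>i<N. \<bar>C i\<bar>)"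
    proof -
      have "C (n mod N) \<le> \<bar>C (n mod N)\<bar>" by simp
      also have "\<dots> \<le> (\<Sum>i<N. \<bar>C i\<bar>)" using N by (intro member_le_sum) auto
      finally show ?thesis .
    qed
    finally show "norm ((f ^^ n) w) \<le> (\<Sum>i<N. \<bar>C i\<bar>)" .
  qed
qed

text \<open>
  By analytic continuation the iterate would be the identity on the plane, and all orbits would be
  locally bounded.
\<close>

lemma no_iterate_is_identity:
  assumes f: "transcendental_entire f" and N: "N > 0"
    and id: "\<And>z. z \<in> U \<Longrightarrow> (f ^^ N) z = z" and U: "open U" "U \<noteq> {}"
  shows False
proof -
  have fe: "entire f" using f by (simp add: transcendental_entire_def)
  have idall: "(f ^^ N) z = z" for z
    by (rule analytic_continuation_open[of U UNIV "f ^^ N" "\<lambda>z. z"])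
       (use U id entire_funpow[OF fe, of N] in \<open>auto simp: entire_def connected_UNIV\<close>)
  have iter: "(f ^^ (N * k)) z = z" for k z
    by (induction k) (auto simp: funpow_add idall)
  have "z \<in> bounded_orbit_set f" for z
  proof (rule bounded_subsequence_imp_bounded_orbit_set[OF fe open_ball _ N, of z z 1 "norm z + 1"])
    fix k w assume "w \<in> ball z 1"
    then have "norm w \<le> norm z + 1"
      by (smt (verit) dist_norm mem_ball norm_minus_commute norm_triangle_sub)
    then show "norm ((f ^^ (N * k)) w) \<le> norm z + 1" by (simp add: iter)
  qed simp
  then show False using bounded_orbit_set_ne_UNIV[OF f] by blast
qed

lemma funpow_fixed_mult:
  assumes "(f ^^ p) a = a"
  shows "(f ^^ (p * k)) a = a"
  by (induction k) (auto simp: funpow_add assms)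

text \<open>
  In a Riemann coordinate vanishing at \<open>a\<close>, an iterate that fixes both points satisfies equality in
  Schwarz's lemma at \<open>b\<close>.  So it is linear, and having a second fixed point it is the identity.
\<close>

lemma periodic_point_unique_in_component:
  assumes f: "transcendental_entire f"
    and a: "a \<in> bounded_orbit_set f" "p > 0" "(f ^^ p) a = a"
    and b: "b \<in> orbit_component f a" "q > 0" "(f ^^ q) b = b"
  shows "b = a"
proof (rule ccontr)
  assume "b \<noteq> a"
  have fe: "entire f" using f by (simp add: transcendental_entire_def)
  define h where "h = f ^^ (p * q)"
  define W where "W = orbit_component f a"
  have h: "entire h" "h a = a" "h b = b"
    using entire_funpow[OF fe] funpow_fixed_mult[OF a(3), of q] funpow_fixed_mult[OF b(3), of p]
    by (auto simp: h_def mult.commute)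
  have hB: "h z \<in> bounded_orbit_set f" if "z \<in> bounded_orbit_set f" for z
    unfolding h_def using bounded_orbit_set_image[OF fe transcendental_not_constant[OF f] that] .
  have hW: "h z \<in> W" if "z \<in> W" for z
    using image_orbit_component[OF h(1) hB, of z a] that h(2) unfolding W_def by auto
  obtain \<theta> \<psi> where D: "conformal_disc_at W a \<theta> \<psi>"
    unfolding W_def by (rule bounded_orbit_component_conformal_disc[OF f a(1)])
  define F where "F = \<theta> \<circ> (h \<circ> \<psi>)"
  have F: "F holomorphic_on ball 0 1" "F 0 = 0" "\<And>u. norm u < 1 \<Longrightarrow> norm (F u) < 1"
    using conformal_disc_conjugate[OF D D h(1) hW] D h(2)
    by (auto simp: F_def conformal_disc_at_def image_subset_iff)
  have bW: "b \<in> W" using b(1) by (simp add: W_def)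
  have \<theta>b: "norm (\<theta> b) < 1" "\<psi> (\<theta> b) = b" using D bW by (auto simp: conformal_disc_at_def)
  then have "\<theta> b \<noteq> 0" using \<open>b \<noteq> a\<close> D by (auto simp: conformal_disc_at_def)
  have Fb: "F (\<theta> b) = \<theta> b" using \<theta>b h(3) by (simp add: F_def)
  then obtain \<alpha> where \<alpha>: "\<forall>u. norm u < 1 \<longrightarrow> F u = \<alpha> * u"
    using Schwarz_Lemma(3)[OF F \<theta>b(1)] \<theta>b(1) \<open>\<theta> b \<noteq> 0\<close> by metis
  then have "\<alpha> = 1" using \<theta>b(1) Fb \<open>\<theta> b \<noteq> 0\<close> by force
  have "h z = z" if "z \<in> W" for z
  proof -
    have "norm (\<theta> z) < 1" "\<psi> (\<theta> z) = z" "\<psi> (\<theta> (h z)) = h z"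
      using D that hW[OF that] by (auto simp: conformal_disc_at_def)
    then show ?thesis using \<alpha> \<open>\<alpha> = 1\<close> unfolding F_def by (metis comp_apply mult_1)
  qed
  then show False
    using no_iterate_is_identity[OF f, of "p * q" W] a(2) b(2) orbit_component_basics(1)[of f a] orbit_component_basics(5)[OF a(1)]
    unfolding h_def W_def by (metis empty_iff nat_0_less_mult_iff)
qed

section \<open>Periodic components meet the postsingular set\<close>

text \<open>
  If the powers converge along a subsequence, then the quotients of its distant terms tend to \<open>1\<close>.
\<close>

lemma unit_complex_recurrent:
  fixes \<kappa> :: complex
  assumes "norm \<kappa> = 1"
  obtains m :: "nat \<Rightarrow> nat" where "\<And>j. m j \<ge> j" "(\<lambda>j. \<kappa> ^ m j) \<longlonglongrightarrow> 1"
proof -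
  have ne: "\<kappa> \<noteq> 0" using assms by auto
  have "\<forall>n. \<kappa> ^ n \<in> cball 0 1" using assms by (simp add: norm_power)
  then obtain L s where s: "strict_mono (s :: nat \<Rightarrow> nat)" "((\<lambda>n. \<kappa> ^ n) \<circ> s) \<longlonglongrightarrow> L"
    using compact_cball[of "0::complex" 1] unfolding compact_def by metis
  have lim: "(\<lambda>j. \<kappa> ^ s j) \<longlonglongrightarrow> L" using s(2) by (simp add: o_def)
  have "(\<lambda>j. norm (\<kappa> ^ s j)) \<longlonglongrightarrow> norm L" by (intro tendsto_norm lim)
  then have "norm L = 1" using assms by (simp add: norm_power LIMSEQ_const_iff)
  then have L: "L \<noteq> 0" by auto
  have lim2: "(\<lambda>j. \<kappa> ^ s (2 * j)) \<longlonglongrightarrow> L"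
    using LIMSEQ_subseq_LIMSEQ[OF lim, of "\<lambda>j. 2 * j"] by (simp add: strict_mono_def o_def)
  have ge: "s (2 * j) \<ge> s j + j" for j
  proof -
    have "s (j + i) \<ge> s j + i" for i
    proof (induction i)
      case (Suc i)
      have "s (j + i) < s (j + Suc i)" using s(1) by (simp add: strict_mono_def)
      then show ?case using Suc by simp
    qed simp
    from this[of j] show ?thesis by (simp add: mult_2)
  qed
  have "\<kappa> ^ s (2 * j) / \<kappa> ^ s j = \<kappa> ^ (s (2 * j) - s j)" for j
    using ge[of j] ne by (simp add: power_diff)
  moreover have "(\<lambda>j. \<kappa> ^ s (2 * j) / \<kappa> ^ s j) \<longlonglongrightarrow> L / L"
    by (intro tendsto_divide lim lim2 L)
  ultimately have "(\<lambda>j. \<kappa> ^ (s (2 * j) - s j)) \<longlonglongrightarrow> 1" using L by simp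
  moreover have "s (2 * j) - s j \<ge> j" for j using ge[of j] by linarith
  ultimately show ?thesis by (rule that[rotated])
qed

text \<open>
  Off the postsingular set the branch of the inverse of \<open>f ^^ q\<close> that fixes \<open>a\<close> is defined on the whole
  component and, as \<open>B\<close> is backward invariant, maps it into itself.  Thus neither \<open>f ^^ q\<close> nor
  this branch increases the modulus in the Riemann coordinate, and equality in Schwarz's lemma follows.
\<close>

lemma component_off_postsingular_is_rotation:
  assumes f: "transcendental_entire f"
    and a: "a \<in> bounded_orbit_set f" "(f ^^ q) a = a"
    and W: "orbit_component f a \<inter> postsingular_set f = {}"
    and D: "conformal_disc_at (orbit_component f a) a \<theta> \<psi>"
  obtains \<kappa> where "norm \<kappa> = 1" "\<And>u. norm u < 1 \<Longrightarrow> (f ^^ q) (\<psi> u) = \<psi> (\<kappa> * u)"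
proof -
  define W where "W = orbit_component f a"
  note D = D[folded W_def]
  have fe: "entire f" using f by (simp add: transcendental_entire_def)
  note nc = transcendental_not_constant[OF f]
  define h where "h = f ^^ q"
  have h: "entire h" "h a = a" using entire_funpow[OF fe] a(2) by (auto simp: h_def)
  have hB: "h z \<in> bounded_orbit_set f" if "z \<in> bounded_orbit_set f" for z
    unfolding h_def using bounded_orbit_set_image[OF fe nc that] .
  have hW: "h z \<in> W" if "z \<in> W" for z
    using image_orbit_component[OF h(1) hB, of z a] that h(2) unfolding W_def by auto
  have \<psi>: "\<psi> holomorphic_on ball 0 1" "\<And>u. u \<in> ball 0 1 \<Longrightarrow> \<psi> u \<in> W" "\<psi> 0 = a"
    using D by (auto simp: conformal_disc_at_def)
  have "\<exists>\<phi>. is_lift (f ^^ q) \<psi> (ball 0 1) \<phi> \<and> \<phi> 0 = a"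
  proof (rule lift_exists_funpow[OF fe nc zero_less_one \<psi>(1)])
    show "\<psi> z \<notin> postsingular_set f" if "z \<in> ball 0 1" for z
      using \<psi>(2)[OF that] W by (auto simp: W_def)
    show "(f ^^ q) a = \<psi> 0" using a(2) \<psi>(3) by simp
  qed
  then obtain \<phi> where \<phi>: "\<phi> holomorphic_on ball 0 1" "\<And>u. u \<in> ball 0 1 \<Longrightarrow> h (\<phi> u) = \<psi> u" "\<phi> 0 = a"
    unfolding is_lift_def h_def by blast
  have "\<phi> ` ball 0 1 \<subseteq> orbit_component f a"
  proof (rule connected_subset_orbit_component[where p = a])
    show "connected (\<phi> ` ball 0 1)"
      by (intro connected_continuous_image holomorphic_on_imp_continuous_on \<phi>(1) connected_ball)
    show "\<phi> ` ball 0 1 \<subseteq> bounded_orbit_set f"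
    proof
      fix y assume "y \<in> \<phi> ` ball 0 1"
      then obtain u where u: "u \<in> ball 0 1" "y = \<phi> u" by blast
      then have "(f ^^ q) y \<in> W" using \<phi>(2)[OF u(1)] \<psi>(2)[OF u(1)] by (simp add: h_def)
      then show "y \<in> bounded_orbit_set f"
        using orbit_component_basics(3) bounded_orbit_set_vimage_funpow[OF fe] unfolding W_def by blast
    qed
    show "a \<in> \<phi> ` ball 0 1" using \<phi>(3) by (intro image_eqI[of _ _ 0]) auto
    show "a \<in> orbit_component f a" by (rule orbit_component_basics(5)[OF a(1)])
  qed
  then have \<phi>W: "\<phi> u \<in> W" if "u \<in> ball 0 1" for u using that unfolding W_def by blast
  define F where "F = \<theta> \<circ> (h \<circ> \<psi>)"
  have F: "F holomorphic_on ball 0 1" "F 0 = 0" "\<And>u. norm u < 1 \<Longrightarrow> norm (F u) < 1"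
    using conformal_disc_conjugate[OF D D h(1) hW] D h(2)
    by (auto simp: F_def conformal_disc_at_def image_subset_iff)
  define G where "G = \<theta> \<circ> \<phi>"
  have G: "G holomorphic_on ball 0 1" "G 0 = 0" "\<And>u. norm u < 1 \<Longrightarrow> norm (G u) < 1"
  proof -
    show "G holomorphic_on ball 0 1"
      unfolding G_def using D \<phi>(1) \<phi>W
      by (intro holomorphic_on_compose_gen[of _ _ \<theta> W]) (auto simp: conformal_disc_at_def)
    show "G 0 = 0" using \<phi>(3) D by (simp add: G_def conformal_disc_at_def)
    show "norm (G u) < 1" if "norm u < 1" for u
      using \<phi>W[of u] that D by (simp add: G_def conformal_disc_at_def)
  qed
  have FG: "F (G u) = u" if "u \<in> ball 0 1" for u
    using D \<phi>W[OF that] \<phi>(2)[OF that] that by (simp add: F_def G_def conformal_disc_at_def)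
  define u :: complex where "u = 1/2"
  have u: "norm u < 1" "u \<noteq> 0" by (auto simp: u_def)
  have 1: "norm (G u) \<le> norm u" by (rule Schwarz_Lemma(1)[OF G u(1)])
  have 2: "norm (F (G u)) \<le> norm (G u)" by (rule Schwarz_Lemma(1)[OF F G(3)[OF u(1)]])
  have "norm (F (G u)) = norm (G u)" "G u \<noteq> 0"
    using 1 2 FG[of u] u by (auto simp: F(2))
  then obtain \<kappa> where \<kappa>: "\<forall>u. norm u < 1 \<longrightarrow> F u = \<kappa> * u" "norm \<kappa> = 1"
    using Schwarz_Lemma(3)[OF F G(3)[OF u(1)]] G(3)[OF u(1)] by metis
  have "h (\<psi> v) = \<psi> (\<kappa> * v)" if "norm v < 1" for v
  proof -
    have "h (\<psi> v) \<in> W" using hW \<psi>(2) that by simp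
    then have "\<psi> (F v) = h (\<psi> v)" using D by (simp add: F_def conformal_disc_at_def)
    then show ?thesis using \<kappa>(1) that by simp
  qed
  then show ?thesis using that \<kappa>(2) unfolding h_def by blast
qed

text \<open>
  Suppose not, so that \<open>f ^^ q\<close> is a rotation by \<open>\<kappa>\<close> in the Riemann coordinate of the component \<open>W\<close>.  Take a
  small disc around a point \<open>w0\<close> of \<open>W\<close>, off \<open>P\<close> and \<open>a\<close>, that contains a boundary point \<open>\<zeta>\<close>
  of \<open>W\<close>.  The inverse branch \<open>\<phi> n\<close> of \<open>f ^^ (q * n)\<close> that is the inverse rotation near \<open>w0\<close>
  exists on the whole disc.  It omits \<open>a\<close> and every point of \<open>P\<close>, so Schottky's theorem bounds all
  \<open>\<phi> n\<close> by one constant \<open>M\<close> near \<open>\<zeta>\<close>.  As the rotation is recurrent, \<open>f ^^ (q * k)\<close> is near \<open>w0\<close> a limit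
  of maps \<open>\<phi> n\<close>.  By Montel's theorem and analytic continuation it is such a limit near \<open>\<zeta>\<close> too,
  and is bounded by \<open>M\<close> there.  But then \<open>\<zeta>\<close> belongs to \<open>B\<close>.
\<close>

lemma periodic_component_meets_postsingular:
  assumes f: "transcendental_entire f"
    and P: "postsingular_set f \<subseteq> bounded_orbit_set f" "postsingular_set f \<noteq> {}"
    and a: "a \<in> bounded_orbit_set f" "q > 0" "(f ^^ q) a = a"
  shows "orbit_component f a \<inter> postsingular_set f \<noteq> {}"
proof
  assume WP: "orbit_component f a \<inter> postsingular_set f = {}"
  define W where "W = orbit_component f a"
  have fe: "entire f" using f by (simp add: transcendental_entire_def)
  note nc = transcendental_not_constant[OF f]
  obtain \<theta> \<psi> where D: "conformal_disc_at W a \<theta> \<psi>"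
    unfolding W_def by (rule bounded_orbit_component_conformal_disc[OF f a(1)])
  obtain \<kappa> where \<kappa>: "norm \<kappa> = 1" and rot: "\<And>u. norm u < 1 \<Longrightarrow> (f ^^ q) (\<psi> u) = \<psi> (\<kappa> * u)"
    using component_off_postsingular_is_rotation[OF f a(1,3) WP D[unfolded W_def]] by metis
  define \<mu> where "\<mu> = inverse \<kappa>"
  have "\<kappa> \<noteq> 0" using \<kappa> by auto
  then have \<mu>: "norm \<mu> = 1" "\<kappa> * \<mu> = 1" using \<kappa> by (auto simp: \<mu>_def norm_inverse)
  have rotn: "(f ^^ (q * n)) (\<psi> u) = \<psi> (\<kappa> ^ n * u)" if "norm u < 1" for n u
  proof (induction n)
    case (Suc n)
    have "norm (\<kappa> ^ n * u) < 1" using that \<kappa> by (simp add: norm_mult norm_power)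
    then show ?case using Suc rot by (simp add: funpow_add mult.assoc)
  qed simp
  have W: "open W" "connected W" "W \<subseteq> bounded_orbit_set f" "a \<in> W"
    unfolding W_def using orbit_component_basics a(1) by auto
  have \<theta>: "norm (\<theta> z) < 1" "\<psi> (\<theta> z) = z" if "z \<in> W" for z
    using D that by (auto simp: conformal_disc_at_def)
  have \<psi>: "\<psi> holomorphic_on ball 0 1" "\<And>u. norm u < 1 \<Longrightarrow> \<psi> u \<in> W" "\<And>u. norm u < 1 \<Longrightarrow> \<theta> (\<psi> u) = u"
    using D by (auto simp: conformal_disc_at_def)
  have "W \<noteq> UNIV" using W(3) bounded_orbit_set_ne_UNIV[OF f] by blast
  then obtain \<zeta> where \<zeta>: "\<zeta> \<in> frontier W" using frontier_not_empty W(4) by blast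
  have "\<zeta> \<in> frontier (bounded_orbit_set f)"
    using \<zeta> frontier_of_connected_component_subset unfolding W_def by blast
  then have \<zeta>B: "\<zeta> \<notin> bounded_orbit_set f"
    using frontier_disjoint_eq[of "bounded_orbit_set f"] open_bounded_orbit_set by blast
  have "open (- (insert a (postsingular_set f)))"
    by (intro open_Compl closed_insert) (simp add: postsingular_set_def)
  moreover have "\<zeta> \<in> - (insert a (postsingular_set f))" using \<zeta>B P(1) a(1) by blast
  ultimately obtain \<epsilon>0 where \<epsilon>0: "\<epsilon>0 > 0" "ball \<zeta> \<epsilon>0 \<subseteq> - (insert a (postsingular_set f))"
    using open_contains_ball by blast
  \<comment> \<open>The branches live on \<open>ball w0 (4 * \<epsilon>)\<close>; they are holomorphic on \<open>cball w0 (2 * \<epsilon>)\<close>, where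
    Schottky's theorem is applied, and bounded on \<open>ball w0 \<epsilon>\<close>, which contains \<open>\<zeta>\<close>.\<close>
  define \<epsilon> where "\<epsilon> = \<epsilon>0 / 5"
  have \<epsilon>: "\<epsilon> > 0" using \<epsilon>0(1) by (simp add: \<epsilon>_def)
  obtain w0 where w0: "w0 \<in> W" "dist w0 \<zeta> < \<epsilon>"
    using \<zeta> \<epsilon> closure_approachable[of \<zeta> W] unfolding frontier_def by blast
  have big: "ball w0 (4 * \<epsilon>) \<subseteq> - (insert a (postsingular_set f))"
  proof -
    have "ball w0 (4 * \<epsilon>) \<subseteq> ball \<zeta> \<epsilon>0"
      using w0(2) by (simp add: ball_subset_ball_iff \<epsilon>_def dist_commute)
    then show ?thesis using \<epsilon>0(2) by blast
  qed
  obtain p where p: "p \<in> postsingular_set f" using P(2) by blast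
  have "p \<noteq> a" using p WP W(4) unfolding W_def by blast
  define u0 where "u0 = \<theta> w0"
  have u0: "norm u0 < 1" "\<psi> u0 = w0" using \<theta>[OF w0(1)] by (auto simp: u0_def)
  have \<mu>u: "norm (\<mu> ^ n * u) = norm u" "\<kappa> ^ n * (\<mu> ^ n * u) = u" for n u
  proof -
    show "norm (\<mu> ^ n * u) = norm u" using \<mu>(1) by (simp add: norm_mult norm_power)
    have "\<kappa> ^ n * (\<mu> ^ n * u) = (\<kappa> * \<mu>) ^ n * u" by (simp add: power_mult_distrib)
    then show "\<kappa> ^ n * (\<mu> ^ n * u) = u" using \<mu>(2) by simp
  qed
  have "\<exists>\<phi>. is_lift (f ^^ (q * n)) (\<lambda>z. z) (ball w0 (4 * \<epsilon>)) \<phi> \<and> \<phi> w0 = \<psi> (\<mu> ^ n * u0)" for n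
  proof (rule lift_exists_funpow[OF fe nc])
    show "(f ^^ (q * n)) (\<psi> (\<mu> ^ n * u0)) = w0"
      using rotn[of "\<mu> ^ n * u0" n] \<mu>u u0 by simp
  qed (use \<epsilon> big in auto)
  then obtain \<phi> where lift: "\<And>n. is_lift (f ^^ (q * n)) (\<lambda>z. z) (ball w0 (4 * \<epsilon>)) (\<phi> n)"
    and \<phi>w0: "\<And>n. \<phi> n w0 = \<psi> (\<mu> ^ n * u0)"
    by metis
  have hol\<phi>: "\<phi> n holomorphic_on ball w0 (4 * \<epsilon>)" for n using lift by (simp add: is_lift_def)
  have inv\<phi>: "(f ^^ (q * n)) (\<phi> n z) = z" if "z \<in> ball w0 (4 * \<epsilon>)" for n z
    using lift that by (simp add: is_lift_def)
  have "\<exists>M. \<forall>n. \<forall>z\<in>ball w0 \<epsilon>. norm (\<phi> n z) \<le> M"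
  proof -
    have "compact (\<psi> ` cball 0 (norm u0))"
      using \<psi>(1) u0(1)
      by (intro compact_continuous_image holomorphic_on_imp_continuous_on)
         (auto intro: holomorphic_on_subset)
    then obtain C where C: "\<And>u. u \<in> cball 0 (norm u0) \<Longrightarrow> norm (\<psi> u) \<le> C"
      by (metis bounded_iff compact_imp_bounded imageI)
    define r where "r = (C + norm a) / norm (p - a)"
    define M where "M = exp (pi * exp (pi * (2 + 2 * r + 12))) * norm (p - a) + norm a"
    have "norm (\<phi> n z) \<le> M" if z: "z \<in> ball w0 \<epsilon>" for n z
    proof -
      have "norm (\<phi> n z - a) \<le> exp (pi * exp (pi * (2 + 2 * r + 12))) * norm (p - a)"
      proof (rule Schottky_two_values[of "\<phi> n" w0 "2 * \<epsilon>"])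
        show "\<phi> n holomorphic_on cball w0 (2 * \<epsilon>)"
          using \<epsilon> by (intro holomorphic_on_subset[OF hol\<phi>]) (auto simp: cball_subset_ball_iff)
        have "norm (\<phi> n w0 - a) \<le> C + norm a"
          using C[of "\<mu> ^ n * u0"] \<mu>u(1)[of n u0] \<phi>w0[of n] norm_triangle_ineq4[of "\<phi> n w0" a] by simp
        then show "norm (\<phi> n w0 - a) \<le> r * norm (p - a)"
          using \<open>p \<noteq> a\<close> by (simp add: r_def)
        show "\<phi> n v \<noteq> a \<and> \<phi> n v \<noteq> p" if "v \<in> cball w0 (2 * \<epsilon>)" for v
        proof -
          have v: "v \<in> ball w0 (4 * \<epsilon>)" using that \<epsilon> by simp
          then have "v \<noteq> a" "v \<notin> postsingular_set f" using big by auto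
          then show ?thesis
            using inv\<phi>[OF v, of n] funpow_fixed_mult[OF a(3), of n] postsingular_invariant[OF fe p, of "q * n"]
            by metis
        qed
      qed (use \<epsilon> z \<open>p \<noteq> a\<close> in auto)
      then show ?thesis
        using norm_triangle_ineq2[of "\<phi> n z" a] unfolding M_def by linarith
    qed
    then show ?thesis by blast
  qed
  then obtain M where M: "\<And>n z. z \<in> ball w0 \<epsilon> \<Longrightarrow> norm (\<phi> n z) \<le> M" by blast
  obtain \<delta>0 where \<delta>0: "\<delta>0 > 0" "ball w0 \<delta>0 \<subseteq> W" using W(1) w0(1) open_contains_ball by blast
  define \<delta> where "\<delta> = min \<delta>0 \<epsilon>"
  have \<delta>: "\<delta> > 0" "ball w0 \<delta> \<subseteq> W" "ball w0 \<delta> \<subseteq> ball w0 \<epsilon>" "ball w0 \<delta> \<subseteq> ball w0 (4 * \<epsilon>)"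
    using \<delta>0 \<epsilon> by (auto simp: \<delta>_def)
  have near: "\<phi> n z = \<psi> (\<mu> ^ n * \<theta> z)" if z: "z \<in> ball w0 \<delta>" for n z
  proof -
    have "\<phi> n ` ball w0 \<delta> \<subseteq> orbit_component f a"
    proof (rule connected_subset_orbit_component[where p = "\<phi> n w0"])
      show "connected (\<phi> n ` ball w0 \<delta>)"
        using holomorphic_on_subset[OF hol\<phi> \<delta>(4)]
        by (intro connected_continuous_image holomorphic_on_imp_continuous_on connected_ball)
      show "\<phi> n ` ball w0 \<delta> \<subseteq> bounded_orbit_set f"
      proof
        fix y assume "y \<in> \<phi> n ` ball w0 \<delta>"
        then obtain v where v: "v \<in> ball w0 \<delta>" "y = \<phi> n v" by blast
        then have "(f ^^ (q * n)) y = v" using inv\<phi> \<delta>(4) by blast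
        then have "(f ^^ (q * n)) y \<in> bounded_orbit_set f" using v(1) \<delta>(2) W(3) by blast
        then show "y \<in> bounded_orbit_set f" by (rule bounded_orbit_set_vimage_funpow[OF fe])
      qed
      show "\<phi> n w0 \<in> \<phi> n ` ball w0 \<delta>" using \<delta>(1) by simp
      show "\<phi> n w0 \<in> orbit_component f a"
        using \<psi>(2)[of "\<mu> ^ n * u0"] \<mu>u(1) u0(1) \<phi>w0 by (simp add: W_def)
    qed
    then have yW: "\<phi> n z \<in> W" using z unfolding W_def by blast
    define u where "u = \<theta> (\<phi> n z)"
    have u: "norm u < 1" "\<psi> u = \<phi> n z" using \<theta>[OF yW] by (auto simp: u_def)
    have "z = (f ^^ (q * n)) (\<psi> u)" using inv\<phi> z \<delta>(4) u(2) by (metis subsetD)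
    also have "\<dots> = \<psi> (\<kappa> ^ n * u)" by (rule rotn[OF u(1)])
    finally have "\<theta> z = \<kappa> ^ n * u"
      using \<psi>(3)[of "\<kappa> ^ n * u"] u(1) \<kappa> by (simp add: norm_mult norm_power)
    then have "\<mu> ^ n * \<theta> z = (\<kappa> * \<mu>) ^ n * u" by (simp add: power_mult_distrib)
    then show ?thesis using \<mu>(2) u(2) by simp
  qed
  obtain m :: "nat \<Rightarrow> nat" where m: "\<And>j. m j \<ge> j" "(\<lambda>j. \<mu> ^ m j) \<longlonglongrightarrow> 1"
    using unit_complex_recurrent[OF \<mu>(1)] by blast
  have bound: "norm ((f ^^ (q * k)) z) \<le> M" if z: "z \<in> ball w0 \<epsilon>" for k z
  proof -
    \<comment> \<open>near \<open>w0\<close> this is the rotation by \<open>\<mu> ^ m (j + k) * \<kappa> ^ k\<close>, which tends to \<open>\<kappa> ^ k\<close>;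
      the shift by \<open>k\<close> keeps the subtraction from truncating\<close>
    define s where "s j = \<phi> (m (j + k) - k)" for j
    have shol: "s j holomorphic_on ball w0 \<epsilon>" for j
      unfolding s_def by (intro holomorphic_on_subset[OF hol\<phi>]) (use \<epsilon> in auto)
    obtain l r where l: "l holomorphic_on ball w0 \<epsilon>" "strict_mono (r :: nat \<Rightarrow> nat)"
      "\<And>v. v \<in> ball w0 \<epsilon> \<Longrightarrow> (\<lambda>n. s (r n) v) \<longlonglongrightarrow> l v"
    proof (rule Montel[of "ball w0 \<epsilon>" "range s" s])
      show "\<exists>B. \<forall>h\<in>range s. \<forall>z\<in>K. cmod (h z) \<le> B" if "compact K" "K \<subseteq> ball w0 \<epsilon>" for K
        using M that unfolding s_def by blast
    qed (use shol in auto)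
    have "l v = (f ^^ (q * k)) v" if v: "v \<in> ball w0 \<delta>" for v
    proof -
      have vW: "v \<in> W" using v \<delta>(2) by blast
      have "(\<lambda>n. \<mu> ^ m (r n + k)) \<longlonglongrightarrow> 1"
      proof -
        have "strict_mono (\<lambda>n. r n + k)" using l(2) by (simp add: strict_mono_def)
        from LIMSEQ_subseq_LIMSEQ[OF m(2) this] show ?thesis by (simp add: o_def)
      qed
      then have "(\<lambda>n. \<mu> ^ m (r n + k) * (\<kappa> ^ k * \<theta> v)) \<longlonglongrightarrow> 1 * (\<kappa> ^ k * \<theta> v)"
        by (intro tendsto_mult tendsto_const)
      moreover have "\<mu> ^ m (r n + k) * (\<kappa> ^ k * \<theta> v) = \<mu> ^ (m (r n + k) - k) * \<theta> v" for n
      proof -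
        have "k \<le> m (r n + k)" using m(1)[of "r n + k"] by simp
        then have "\<mu> ^ m (r n + k) = \<mu> ^ (m (r n + k) - k) * \<mu> ^ k"
          by (simp flip: power_add)
        then have "\<mu> ^ m (r n + k) * (\<kappa> ^ k * \<theta> v) = \<mu> ^ (m (r n + k) - k) * (\<kappa> ^ k * (\<mu> ^ k * \<theta> v))"
          by (simp only: mult_ac)
        then show ?thesis by (simp only: \<mu>u(2))
      qed
      ultimately have "(\<lambda>n. \<mu> ^ (m (r n + k) - k) * \<theta> v) \<longlonglongrightarrow> \<kappa> ^ k * \<theta> v" by simp
      moreover have "isCont \<psi> (\<kappa> ^ k * \<theta> v)"
      proof -
        have "\<kappa> ^ k * \<theta> v \<in> ball 0 1" using \<theta>(1)[OF vW] \<kappa> by (simp add: norm_mult norm_power)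
        then show ?thesis
          using continuous_on_eq_continuous_at[OF open_ball] holomorphic_on_imp_continuous_on[OF \<psi>(1)] by blast
      qed
      ultimately have "(\<lambda>n. \<psi> (\<mu> ^ (m (r n + k) - k) * \<theta> v)) \<longlonglongrightarrow> \<psi> (\<kappa> ^ k * \<theta> v)"
        by (intro isCont_tendsto_compose[of _ \<psi>])
      then have "(\<lambda>n. s (r n) v) \<longlonglongrightarrow> \<psi> (\<kappa> ^ k * \<theta> v)"
        using near[OF v] by (simp add: s_def)
      then have "l v = \<psi> (\<kappa> ^ k * \<theta> v)"
        using l(3)[of v] v \<delta>(3) LIMSEQ_unique by blast
      then show ?thesis using rotn[OF \<theta>(1)[OF vW], of k] \<theta>(2)[OF vW] by simp
    qed
    then have "l z = (f ^^ (q * k)) z"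
      using analytic_continuation_open[of "ball w0 \<delta>" "ball w0 \<epsilon>" l "f ^^ (q * k)" z] l(1) z \<delta>(1,3)
        entire_funpow[OF fe, of "q * k"] unfolding entire_def
      by (auto intro: holomorphic_on_subset)
    moreover have "norm (l z) \<le> M"
      by (rule LIMSEQ_le_const2[OF tendsto_norm[OF l(3)[OF z]]]) (use M[OF z] in \<open>auto simp: s_def\<close>)
    ultimately show ?thesis by simp
  qed
  have "\<zeta> \<in> ball w0 \<epsilon>" using w0(2) by simp
  then have "\<zeta> \<in> bounded_orbit_set f"
    using bounded_subsequence_imp_bounded_orbit_set[OF fe open_ball _ a(2) bound] by blast
  then show False using \<zeta>B by blast
qed

section \<open>Absorbing discs around the periodic points\<close>

definition bounded_periodic_points :: "(complex \<Rightarrow> complex) \<Rightarrow> complex set" where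
  "bounded_periodic_points f = {a \<in> bounded_orbit_set f. \<exists>q>0. (f ^^ q) a = a}"

lemma finite_components_cover:
  assumes "compact K" "K \<subseteq> bounded_orbit_set f"
  obtains D where "finite D" "D \<subseteq> components (bounded_orbit_set f)" "K \<subseteq> \<Union>D"
proof -
  have "\<And>C. C \<in> components (bounded_orbit_set f) \<Longrightarrow> open C"
    by (rule open_components[OF open_bounded_orbit_set])
  moreover have "K \<subseteq> \<Union>(components (bounded_orbit_set f))" using assms(2) by simp
  ultimately show ?thesis using compactE[OF assms(1)] that by metis
qed

lemma orbit_component_of_mem:
  assumes "C \<in> components (bounded_orbit_set f)" "z \<in> C"
  shows "C = orbit_component f z"
proof -
  obtain x where "C = orbit_component f x" using assms(1) unfolding components_def by blast
  then show ?thesis using orbit_component_basics(4)[of z f x] assms(2) by simp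
qed

text \<open>
  Distinct periodic points lie in distinct components, all of which meet the postsingular set; being
  compact, this set meets only finitely many.
\<close>

lemma finite_bounded_periodic_points:
  assumes f: "transcendental_entire f"
    and P: "compact (postsingular_set f)" "postsingular_set f \<subseteq> bounded_orbit_set f"
      "postsingular_set f \<noteq> {}"
  shows "finite (bounded_periodic_points f)"
proof -
  obtain D where D: "finite D" "D \<subseteq> components (bounded_orbit_set f)" "postsingular_set f \<subseteq> \<Union>D"
    by (rule finite_components_cover[OF P(1,2)])
  have "orbit_component f ` bounded_periodic_points f \<subseteq> D"
  proof
    fix C assume "C \<in> orbit_component f ` bounded_periodic_points f"
    then obtain a q where a: "a \<in> bounded_orbit_set f" "q > 0" "(f ^^ q) a = a" "C = orbit_component f a"
      unfolding bounded_periodic_points_def by blast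
    obtain x where x: "x \<in> C" "x \<in> postsingular_set f"
      using periodic_component_meets_postsingular[OF f P(2,3) a(1-3)] a(4) by blast
    then obtain C' where C': "C' \<in> D" "x \<in> C'" using D(3) by blast
    then have "C' = orbit_component f x" using D(2) orbit_component_of_mem by blast
    also have "\<dots> = C" using x(1) a(4) orbit_component_basics(4) by blast
    finally show "C \<in> D" using C'(1) by simp
  qed
  then have "finite (orbit_component f ` bounded_periodic_points f)"
    using D(1) finite_subset by blast
  moreover have "inj_on (orbit_component f) (bounded_periodic_points f)"
  proof (rule inj_onI)
    fix a b assume a: "a \<in> bounded_periodic_points f" and b: "b \<in> bounded_periodic_points f"
      and eq: "orbit_component f a = orbit_component f b"
    have "b \<in> orbit_component f a"
      using orbit_component_basics(5)[of b f] b eq unfolding bounded_periodic_points_def by blast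
    then show "a = b"
      using periodic_point_unique_in_component[OF f, of a _ b] a b
      unfolding bounded_periodic_points_def by blast
  qed
  ultimately show ?thesis by (rule finite_imageD)
qed

text \<open>
  In the Riemann coordinate \<open>f ^^ q\<close> is a self-map of the disc, and the part of \<open>K\<close> in the component
  is compact and contains the orbit of \<open>x\<close> under \<open>f ^^ q\<close>.
\<close>

lemma recurrent_orbit_component_has_periodic_point:
  assumes f: "transcendental_entire f"
    and K: "compact K" "K \<subseteq> bounded_orbit_set f" "\<And>n z. z \<in> K \<Longrightarrow> (f ^^ n) z \<in> K"
    and x: "x \<in> K" and q: "q > 0" "(f ^^ q) x \<in> orbit_component f x"
  obtains a where "a \<in> bounded_periodic_points f" "x \<in> orbit_component f a"
proof -
  have fe: "entire f" using f by (simp add: transcendental_entire_def)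
  define h where "h = f ^^ q"
  define W where "W = orbit_component f x"
  have xB: "x \<in> bounded_orbit_set f" using x K by blast
  have h: "entire h" using entire_funpow[OF fe] by (simp add: h_def)
  have hB: "h z \<in> bounded_orbit_set f" if "z \<in> bounded_orbit_set f" for z
    unfolding h_def using bounded_orbit_set_image[OF fe transcendental_not_constant[OF f] that] .
  have hW: "h z \<in> W" if "z \<in> W" for z
    using image_orbit_component[OF h hB, of z x] that orbit_component_basics(4)[OF q(2)]
    unfolding W_def by (simp add: h_def)
  obtain \<theta> \<psi> where D: "conformal_disc_at W x \<theta> \<psi>"
    unfolding W_def by (rule bounded_orbit_component_conformal_disc[OF f xB])
  obtain T where T: "closed T" "W = bounded_orbit_set f \<inter> T"
    using closedin_connected_component[of "bounded_orbit_set f" x] unfolding W_def closedin_closed by blast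
  have "K \<inter> W = K \<inter> T" using T(2) K(2) by blast
  then have KW: "compact (K \<inter> W)" using K(1) T(1) compact_Int_closed by metis
  have orb: "(h ^^ n) x \<in> K \<inter> W" for n
  proof
    show "(h ^^ n) x \<in> K" unfolding h_def funpow_mult by (rule K(3)[OF x])
    show "(h ^^ n) x \<in> W"
      by (induction n) (auto simp: hW, auto simp: W_def xB)
  qed
  define F where "F = \<theta> \<circ> (h \<circ> \<psi>)"
  have F: "F holomorphic_on ball 0 1" "F ` ball 0 1 \<subseteq> ball 0 1"
    using conformal_disc_conjugate[OF D D h hW] by (auto simp: F_def)
  have Forb: "(F ^^ n) (\<theta> x) = \<theta> ((h ^^ n) x)" for n
  proof (induction n)
    case (Suc n)
    have "\<psi> (\<theta> ((h ^^ n) x)) = (h ^^ n) x" using D orb[of n] by (simp add: conformal_disc_at_def)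
    then show ?case using Suc by (simp add: F_def)
  qed simp
  obtain u where u: "u \<in> ball 0 1" "F u = u"
  proof (rule disc_self_map_fixed_point[OF F])
    show "compact (\<theta> ` (K \<inter> W))"
      using D KW unfolding conformal_disc_at_def
      by (intro compact_continuous_image holomorphic_on_imp_continuous_on) (auto intro: holomorphic_on_subset)
    show "\<theta> ` (K \<inter> W) \<subseteq> ball 0 1" using D by (auto simp: conformal_disc_at_def)
    show "(F ^^ n) (\<theta> x) \<in> \<theta> ` (K \<inter> W)" for n using Forb orb by blast
  qed
  have "\<psi> u \<in> W" "h (\<psi> u) \<in> W" using D u(1) hW by (auto simp: conformal_disc_at_def)
  moreover have "h (\<psi> u) = \<psi> (F u)"
    using D \<open>h (\<psi> u) \<in> W\<close> by (simp add: F_def conformal_disc_at_def)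
  ultimately have a: "\<psi> u \<in> W" "(f ^^ q) (\<psi> u) = \<psi> u" using u(2) by (auto simp: h_def)
  have "\<psi> u \<in> bounded_periodic_points f"
    using a q(1) orbit_component_basics(3) unfolding bounded_periodic_points_def W_def by blast
  moreover have "x \<in> orbit_component f (\<psi> u)"
    using a(1) orbit_component_basics(4,5) xB unfolding W_def by blast
  ultimately show ?thesis using that by blast
qed

text \<open>
  The orbit of \<open>z\<close> visits only the finitely many components that meet \<open>K\<close>, so it visits one of them
  twice.
\<close>

lemma eventually_in_periodic_component:
  assumes f: "transcendental_entire f"
    and K: "compact K" "K \<subseteq> bounded_orbit_set f" "\<And>n z. z \<in> K \<Longrightarrow> (f ^^ n) z \<in> K"
    and z: "z \<in> K"
  obtains m a where "a \<in> bounded_periodic_points f" "(f ^^ m) z \<in> orbit_component f a"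
proof -
  obtain D where D: "finite D" "D \<subseteq> components (bounded_orbit_set f)" "K \<subseteq> \<Union>D"
    by (rule finite_components_cover[OF K(1,2)])
  have "orbit_component f ((f ^^ n) z) \<in> D" for n
  proof -
    obtain C where C: "C \<in> D" "(f ^^ n) z \<in> C" using D(3) K(3)[OF z] by blast
    then show ?thesis using orbit_component_of_mem D(2) by blast
  qed
  then have "range (\<lambda>n. orbit_component f ((f ^^ n) z)) \<subseteq> D" by (rule image_subsetI)
  then have "finite (range (\<lambda>n. orbit_component f ((f ^^ n) z)))"
    using D(1) by (rule finite_subset)
  then have "\<not> inj (\<lambda>n. orbit_component f ((f ^^ n) z))"
    using range_inj_infinite by blast
  then obtain i j where ij: "i < j" "orbit_component f ((f ^^ i) z) = orbit_component f ((f ^^ j) z)"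
    unfolding inj_on_def by (metis UNIV_I linorder_neqE_nat)
  define x where "x = (f ^^ i) z"
  have x: "x \<in> K" unfolding x_def by (rule K(3)[OF z])
  have fj: "(f ^^ (j - i)) x = (f ^^ j) z"
    unfolding x_def using ij(1) by (metis comp_apply funpow_add le_add_diff_inverse2 less_imp_le)
  have "(f ^^ j) z \<in> orbit_component f x"
    using ij(2) orbit_component_basics(5)[of "(f ^^ j) z" f] K(2) K(3)[OF z] unfolding x_def by blast
  then obtain a where "a \<in> bounded_periodic_points f" "x \<in> orbit_component f a"
    using recurrent_orbit_component_has_periodic_point[OF f K x, of "j - i"] fj ij(1) by auto
  then show ?thesis using that unfolding x_def by blast
qed

locale periodic_discs =
  fixes f :: "complex \<Rightarrow> complex" and \<theta> \<psi> :: "complex \<Rightarrow> complex \<Rightarrow> complex"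
  assumes transcendental: "transcendental_entire f"
    and finite_periodic: "finite (bounded_periodic_points f)"
    and discs: "\<And>a. a \<in> bounded_periodic_points f \<Longrightarrow> conformal_disc_at (orbit_component f a) a (\<theta> a) (\<psi> a)"
begin

abbreviation "Per \<equiv> bounded_periodic_points f"

definition basin :: "complex set" where
  "basin = (\<Union>a\<in>Per. orbit_component f a)"

definition open_discs :: "real \<Rightarrow> complex set" where
  "open_discs r = (\<Union>a\<in>Per. \<psi> a ` ball 0 r)"

definition closed_discs :: "real \<Rightarrow> complex set" where
  "closed_discs r = (\<Union>a\<in>Per. \<psi> a ` cball 0 r)"

lemma open_open_discs: "r \<le> 1 \<Longrightarrow> open (open_discs r)"
  unfolding open_discs_def
proof (intro open_UN ballI)
  fix a assume a: "a \<in> Per" and r: "r \<le> 1"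
  note D = discs[OF a, unfolded conformal_disc_at_def]
  have "inj_on (\<psi> a) (ball 0 r)"
    using D r by (intro inj_on_inverseI[of _ "\<theta> a"]) auto
  moreover have "\<psi> a holomorphic_on ball 0 r"
    using D r by (auto intro: holomorphic_on_subset)
  ultimately show "open (\<psi> a ` ball 0 r)" by (intro open_mapping_thm3) auto
qed

lemma compact_closed_discs: "r < 1 \<Longrightarrow> compact (closed_discs r)"
  unfolding closed_discs_def
proof (intro compact_UN finite_periodic)
  fix a assume a: "a \<in> Per" and r: "r < 1"
  note D = discs[OF a, unfolded conformal_disc_at_def]
  have "\<psi> a holomorphic_on cball 0 r"
    using D r by (auto intro: holomorphic_on_subset)
  then show "compact (\<psi> a ` cball 0 r)"
    by (intro compact_continuous_image holomorphic_on_imp_continuous_on) auto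
qed

lemma closed_discs_subset_basin: "r < 1 \<Longrightarrow> closed_discs r \<subseteq> basin"
  using discs unfolding closed_discs_def basin_def conformal_disc_at_def by fastforce

lemma open_discs_subset_closed_discs: "open_discs r \<subseteq> closed_discs r"
  unfolding open_discs_def closed_discs_def by fastforce

lemma basin_subset_open_discs: "basin \<subseteq> (\<Union>r\<in>{0<..<1}. open_discs r)"
proof
  fix z assume "z \<in> basin"
  then obtain a where a: "a \<in> Per" "z \<in> orbit_component f a" by (auto simp: basin_def)
  note D = discs[OF a(1), unfolded conformal_disc_at_def]
  define r where "r = (1 + norm (\<theta> a z)) / 2"
  have z: "norm (\<theta> a z) < 1" "\<psi> a (\<theta> a z) = z" using D a(2) by auto
  then have "r \<in> {0<..<1}" "\<theta> a z \<in> ball 0 r"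
    by (auto simp: r_def add_pos_nonneg)
  moreover have "z \<in> \<psi> a ` ball 0 r"
    using z(2) \<open>\<theta> a z \<in> ball 0 r\<close> by (intro image_eqI[of _ _ "\<theta> a z"]) auto
  ultimately show "z \<in> (\<Union>r\<in>{0<..<1}. open_discs r)"
    unfolding open_discs_def using a(1) by blast
qed

lemma open_basin: "open basin"
  unfolding basin_def by (intro open_UN ballI orbit_component_basics)

lemma compact_subset_basin:
  assumes "compact K" "K \<subseteq> basin"
  obtains r where "r < 1" "K \<subseteq> closed_discs r"
proof -
  obtain R where R: "R \<subseteq> {0<..<1}" "finite R" "K \<subseteq> (\<Union>r\<in>R. open_discs r)"
  proof (rule compactE_image[OF assms(1), of "{0<..<1}" open_discs])
    show "K \<subseteq> (\<Union>r\<in>{0<..<1}. open_discs r)" using assms(2) basin_subset_open_discs by blast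
  qed (auto intro: open_open_discs)
  define r where "r = Max (insert (1/2) R)"
  have "r \<in> insert (1/2) R" unfolding r_def using R(2) by (intro Max_in) auto
  then have "r < 1" using R(1) by auto
  moreover have "closed_discs s \<subseteq> closed_discs r" if "s \<in> R" for s
  proof -
    have "s \<le> r" unfolding r_def using R(2) that by (intro Max_ge) auto
    then show ?thesis unfolding closed_discs_def by (intro UN_mono image_mono) auto
  qed
  ultimately show ?thesis
    using that R(3) open_discs_subset_closed_discs by blast
qed

text \<open>
  A map commuting with \<open>f\<close> sends periodic points of \<open>f\<close> to periodic points of \<open>f\<close>, so Schwarz's
  lemma applies to it between the corresponding components.  This includes \<open>f\<close> itself.
\<close>

lemma closed_discs_invariant:
  assumes k: "entire k" "\<not> k constant_on UNIV" "\<And>z. f (k z) = k (f z)"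
    and r: "r < 1" and z: "z \<in> closed_discs r"
  shows "k z \<in> closed_discs r"
proof -
  obtain a u where a: "a \<in> Per" and u: "norm u \<le> r" "z = \<psi> a u"
    using z unfolding closed_discs_def by auto
  have kB: "k w \<in> bounded_orbit_set f" if "w \<in> bounded_orbit_set f" for w
    by (rule bounded_orbit_set_commuting_image[OF k that])
  obtain q where "a \<in> bounded_orbit_set f" "q > 0" "(f ^^ q) a = a"
    using a unfolding bounded_periodic_points_def by blast
  then have ka: "k a \<in> Per"
    using kB funpow_commute[of f k, OF k(3)] unfolding bounded_periodic_points_def by auto
  note D = discs[OF a] and D' = discs[OF ka]
  have zW: "z \<in> orbit_component f a" and "\<theta> a z = u"
    using D u r unfolding conformal_disc_at_def by auto
  have kW: "k w \<in> orbit_component f (k a)" if "w \<in> orbit_component f a" for w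
    by (rule image_orbit_component[OF k(1) kB that])
  have "norm (\<theta> (k a) (k z)) \<le> r"
    using conformal_disc_Schwarz[OF D D' k(1) kW refl zW] u(1) \<open>\<theta> a z = u\<close> by simp
  moreover have "\<psi> (k a) (\<theta> (k a) (k z)) = k z"
    using D' kW[OF zW] unfolding conformal_disc_at_def by blast
  ultimately have "k z \<in> \<psi> (k a) ` cball 0 r"
    by (intro image_eqI[of _ _ "\<theta> (k a) (k z)"]) auto
  then show ?thesis unfolding closed_discs_def using ka by blast
qed

lemma closed_discs_invariant_funpow:
  assumes "entire k" "\<not> k constant_on UNIV" "\<And>z. f (k z) = k (f z)" "r < 1" "z \<in> closed_discs r"
  shows "(k ^^ n) z \<in> closed_discs r"
  using assms(5) by (induction n) (auto intro: closed_discs_invariant[OF assms(1-4)])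

lemma basin_invariant:
  assumes "z \<in> basin" shows "(f ^^ n) z \<in> basin"
proof -
  obtain r where r: "r < 1" "{z} \<subseteq> closed_discs r"
    using compact_subset_basin[of "{z}"] assms by auto
  have "entire f" using transcendental by (simp add: transcendental_entire_def)
  then have "(f ^^ n) z \<in> closed_discs r"
    using closed_discs_invariant_funpow[of f r z n] transcendental_not_constant[OF transcendental] r by auto
  then show ?thesis using closed_discs_subset_basin r by blast
qed

lemma compact_absorbed:
  assumes K: "compact K" "K \<subseteq> bounded_orbit_set f" "\<And>n z. z \<in> K \<Longrightarrow> (f ^^ n) z \<in> K"
  obtains m where "(f ^^ m) ` K \<subseteq> basin"
proof -
  have fe: "entire f" using transcendental by (simp add: transcendental_entire_def)
  have cover: "K \<subseteq> (\<Union>m. (f ^^ m) -` basin)"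
  proof
    fix z assume "z \<in> K"
    then obtain m a where "a \<in> Per" "(f ^^ m) z \<in> orbit_component f a"
      using eventually_in_periodic_component[OF transcendental K] by blast
    then show "z \<in> (\<Union>m. (f ^^ m) -` basin)" unfolding basin_def by blast
  qed
  have op: "open ((f ^^ m) -` basin)" for m
    using entire_imp_continuous_on[OF entire_funpow[OF fe], of UNIV m] open_basin
    by (intro open_vimage)
  obtain N :: "nat set" where N: "finite N" "K \<subseteq> (\<Union>m\<in>N. (f ^^ m) -` basin)"
    using compactE_image[OF K(1), of UNIV "\<lambda>m. (f ^^ m) -` basin"] op cover by metis
  define M where "M = (\<Sum>n\<in>N. n)"
  have "(f ^^ M) z \<in> basin" if "z \<in> K" for z
  proof -
    obtain n where n: "n \<in> N" "(f ^^ n) z \<in> basin" using N(2) \<open>z \<in> K\<close> by blast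
    have "n \<le> M" unfolding M_def using N(1) n(1) by (intro member_le_sum) auto
    then have "(f ^^ M) z = (f ^^ (M - n)) ((f ^^ n) z)"
      by (metis comp_apply funpow_add le_add_diff_inverse2)
    then show ?thesis using basin_invariant[OF n(2)] by simp
  qed
  then show ?thesis using that by blast
qed

end

section \<open>The postsingular set of the composition\<close>

lemma entire_comp: "entire f \<Longrightarrow> entire g \<Longrightarrow> entire (f \<circ> g)"
  unfolding entire_def by (rule holomorphic_on_compose_gen) auto

text \<open>
  After \<open>m\<close> steps \<open>f\<close> has moved the postsingular set into some \<open>closed_discs r\<close>, which is
  invariant under \<open>f\<close> and \<open>g\<close>.  Because \<open>(f \<circ> g) ^^ n = g ^^ n \<circ> f ^^ n\<close>, it contains the images of the singular
  values under \<open>(f \<circ> g) ^^ n\<close> for all \<open>n \<ge> m\<close>.  The earlier images are finitely many compact sets,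
  and their points have locally bounded orbits because this property is inherited by preimages.
\<close>

lemma singular_orbits_of_composition:
  assumes f: "hyperbolic_entire f" "bounded_type f"
    and g: "entire g" "\<not> g constant_on UNIV" and comm: "\<And>z. f (g z) = g (f z)"
  obtains K where "compact K" "K \<subseteq> bounded_orbit_set (f \<circ> g)"
    "\<And>n z. z \<in> singular_values f \<Longrightarrow> ((f \<circ> g) ^^ n) z \<in> K"
proof (cases "postsingular_set f = {}")
  case True
  then have "singular_values f = {}" using singular_subset_postsingular by blast
  then show ?thesis using that[of "{}"] by auto
next
  case False
  let ?h = "f \<circ> g" and ?S = "singular_values f" and ?P = "postsingular_set f"
  have ft: "transcendental_entire f" using f(2) by (simp add: bounded_type_def)
  then have fe: "entire f" by (simp add: transcendental_entire_def)
  note fc = transcendental_not_constant[OF ft]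
  have he: "entire ?h" by (rule entire_comp[OF fe g(1)])
  have P: "compact ?P" "?P \<subseteq> bounded_orbit_set f"
    using f(1) hyperbolic_postsingular_subset by (auto simp: hyperbolic_entire_def)
  have "\<forall>a\<in>bounded_periodic_points f. \<exists>\<theta> \<psi>. conformal_disc_at (orbit_component f a) a \<theta> \<psi>"
    using bounded_orbit_component_conformal_disc[OF ft] unfolding bounded_periodic_points_def by blast
  then obtain \<theta> \<psi> where "\<forall>a\<in>bounded_periodic_points f. conformal_disc_at (orbit_component f a) a (\<theta> a) (\<psi> a)"
    by metis
  then interpret periodic_discs f \<theta> \<psi>
    using ft finite_bounded_periodic_points[OF ft P False] by unfold_locales auto
  have h_inv: "(?h ^^ n) z \<in> closed_discs r" if "r < 1" "z \<in> closed_discs r" for r z n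
    unfolding funpow_comp_commuting[of f g, OF comm]
    using closed_discs_invariant_funpow[OF fe fc refl that] closed_discs_invariant_funpow[OF g comm that(1)]
    by blast
  have basin_h: "basin \<subseteq> bounded_orbit_set ?h"
  proof
    fix z assume "z \<in> basin"
    then have "z \<in> (\<Union>r\<in>{0<..<1}. open_discs r)" using basin_subset_open_discs by blast
    then obtain r where "r \<in> {0<..<1}" "z \<in> open_discs r" by blast
    then have r: "0 < r" "r < 1" "z \<in> open_discs r" by auto
    obtain M where M: "\<And>w. w \<in> closed_discs r \<Longrightarrow> norm w \<le> M"
      using compact_imp_bounded[OF compact_closed_discs[OF r(2)]] unfolding bounded_iff by blast
    show "z \<in> bounded_orbit_set ?h"
    proof (rule bounded_orbit_setI[OF open_open_discs r(3)])
      show "norm ((?h ^^ n) w) \<le> M" if "w \<in> open_discs r" for n w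
        using that open_discs_subset_closed_discs h_inv[OF r(2)] M by blast
    qed (use r in auto)
  qed
  obtain m where m: "(f ^^ m) ` ?P \<subseteq> basin"
    using compact_absorbed[OF P] postsingular_invariant[OF fe] by blast
  have "compact ((f ^^ m) ` ?P)"
    by (intro compact_continuous_image entire_imp_continuous_on entire_funpow fe P(1))
  then obtain r where r: "r < 1" "(f ^^ m) ` ?P \<subseteq> closed_discs r"
    using compact_subset_basin m by blast
  have late: "(?h ^^ n) z \<in> closed_discs r" if "z \<in> ?S" "n \<ge> m" for n z
  proof -
    have "(f ^^ m) z \<in> closed_discs r" using that(1) r(2) singular_subset_postsingular by blast
    then have "(f ^^ (n - m)) ((f ^^ m) z) \<in> closed_discs r"
      by (rule closed_discs_invariant_funpow[OF fe fc refl r(1)])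
    then have "(f ^^ n) z \<in> closed_discs r"
      using that(2) by (metis comp_apply funpow_add le_add_diff_inverse2)
    then show ?thesis
      unfolding funpow_comp_commuting[of f g, OF comm] by (rule closed_discs_invariant_funpow[OF g comm r(1)])
  qed
  have discs_h: "closed_discs r \<subseteq> bounded_orbit_set ?h"
    using closed_discs_subset_basin[OF r(1)] basin_h by blast
  have early: "(?h ^^ n) z \<in> bounded_orbit_set ?h" if "z \<in> ?S" "n < m" for n z
  proof -
    have "(?h ^^ (m - n)) ((?h ^^ n) z) = (?h ^^ m) z"
      using that(2) by (metis comp_apply funpow_add le_add_diff_inverse2 less_imp_le)
    then have "(?h ^^ (m - n)) ((?h ^^ n) z) \<in> bounded_orbit_set ?h"
      using late[OF that(1) order_refl] discs_h by auto
    then show ?thesis by (rule bounded_orbit_set_vimage_funpow[OF he])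
  qed
  have S: "compact ?S"
    using P(1) singular_subset_postsingular[of f]
    by (metis closed_closure closed_subset compact_Int_closed inf.absorb_iff2 singular_values_def)
  define K where "K = closed_discs r \<union> (\<Union>n<m. (?h ^^ n) ` ?S)"
  show ?thesis
  proof (rule that[of K])
    show "compact K"
      unfolding K_def
      by (intro compact_Un compact_closed_discs r compact_UN finite_lessThan compact_continuous_image
          entire_imp_continuous_on entire_funpow he S)
    show "K \<subseteq> bounded_orbit_set ?h" unfolding K_def using discs_h early by blast
    show "(?h ^^ n) z \<in> K" if "z \<in> ?S" for n z
      using late[OF that, of n] that unfolding K_def by (cases "n < m") auto
  qed
qed

theorem theorem2p4:
  fixes f g :: "complex \<Rightarrow> complex"
  assumes "hyperbolic_entire f" and "bounded_type f"
    and "hyperbolic_entire g" and "bounded_type g"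
    and "f \<circ> g = g \<circ> f"
  shows "hyperbolic_entire (f \<circ> g)"
proof -
  let ?h = "f \<circ> g"
  have comm: "f (g z) = g (f z)" for z using assms(5) by (metis comp_apply)
  have ft: "transcendental_entire f" "transcendental_entire g"
    using assms(2,4) by (auto simp: bounded_type_def)
  then have fe: "entire f" "entire g" by (auto simp: transcendental_entire_def)
  note nc = transcendental_not_constant[OF ft(1)] transcendental_not_constant[OF ft(2)]
  have he: "entire ?h" by (rule entire_comp[OF fe])
  obtain K1 where K1: "compact K1" "K1 \<subseteq> bounded_orbit_set ?h"
    "\<And>n z. z \<in> singular_values f \<Longrightarrow> (?h ^^ n) z \<in> K1"
    using singular_orbits_of_composition[OF assms(1,2) fe(2) nc(2) comm] by blast
  obtain K2 where K2: "compact K2" "K2 \<subseteq> bounded_orbit_set ?h"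
    "\<And>n z. z \<in> singular_values g \<Longrightarrow> (?h ^^ n) z \<in> K2"
    using singular_orbits_of_composition[OF assms(3,4) fe(1) nc(1) comm[symmetric]]
    unfolding assms(5)[symmetric] by blast
  have "closed (singular_values g)" unfolding singular_values_def by (rule closed_closure)
  then have Sg: "compact (singular_values g)"
    using assms(4) by (simp add: bounded_type_def compact_eq_bounded_closed)
  have S: "singular_values ?h \<subseteq> singular_values f \<union> f ` singular_values g"
    by (rule singular_values_comp_subset[OF fe nc(1) Sg])
  define K where "K = K1 \<union> f ` K2"
  have K: "compact K"
    unfolding K_def by (intro compact_Un compact_continuous_image entire_imp_continuous_on fe K1 K2)
  have fh: "?h (f z) = f (?h z)" for z using comm by simp
  have "f z \<in> bounded_orbit_set ?h" if "z \<in> K2" for z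
    using bounded_orbit_set_commuting_image[OF fe(1) nc(1), of ?h z] fh that K2(2) by blast
  then have KB: "K \<subseteq> bounded_orbit_set ?h" unfolding K_def using K1(2) by blast
  have "(?h ^^ n) z \<in> K" if z: "z \<in> singular_values ?h" for n z
  proof (cases "z \<in> singular_values f")
    case True
    then show ?thesis using K1(3) by (simp add: K_def)
  next
    case False
    then obtain s where s: "s \<in> singular_values g" "z = f s" using S z by blast
    have "(?h ^^ n) z = f ((?h ^^ n) s)" unfolding s(2) by (rule funpow_commute[of ?h f, OF fh])
    then show ?thesis using K2(3)[OF s(1)] by (simp add: K_def)
  qed
  then have PK: "postsingular_set ?h \<subseteq> K"
    unfolding postsingular_set_def by (intro closure_minimal compact_imp_closed[OF K]) auto
  then have "compact (postsingular_set ?h)"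
    using K unfolding postsingular_set_def
    by (meson bounded_subset closed_closure compact_eq_bounded_closed)
  moreover have "postsingular_set ?h \<subseteq> Fatou_set ?h"
    using PK KB bounded_orbit_set_subset_Fatou[OF he] by blast
  ultimately show ?thesis using he by (simp add: hyperbolic_entire_def)
qed

end
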